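(* Let $X$ be a centered, nondegenerate, infinitely divisible real random variable with finite variance $V>0$ and Lévy measure $\nu$. (First part.) Assume that $\tau>0$ and that $c_*$ has one-sided derivative $-\infty$ at $V$, i.e. $\lim_{v\downarrow V}\frac{c_*(v)-c_*(V)}{v-V}=-\infty$. Then $$y_*(x)<\sqrt{2Vx}+c_*(V)\,x\qquad\text{for every }x>0 .$$ In particular this conclusion holds under either of the following sets of hypotheses: (A) $\int_{|x|>1}x^4\,\nu(dx)<\infty$, $\tau>0$, $m_1>0$, $\kappa>0$, $\Psi_1(t)<m_1$ for every $t>0$, and $m_1>1/\tau$ when $\tau<\infty$; (B) $\int_{|x|>1}|x|^5\,\nu(dx)<\infty$, $\tau>0$, $m_1>0$, $\Psi_1(t)<m_1$ for every $t>0$, $m_1>1/\tau$ when $\tau<\infty$, $\kappa=0$ and $\gamma>0$. (Second part.) Under boundary control, by contrast (that is, if $\tau>0$, $c_*(V)>0$ and $c_*(V)=1/\tau$), the infimum defining $y_*(x)$ is attained at $v=V$ for every $x>0$.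
   Context: Standing setting: $X$ is a centered, nondegenerate, infinitely divisible real random variable with variance $0<V=\mathrm{Var}(X)<\infty$, Gaussian variance $a\ge0$ and Lévy measure $\nu$ on $\mathbb{R}\setminus\{0\}$. For all real $t$, $K_X(t)=\log\mathbb{E}e^{tX}=\frac{at^2}{2}+\int_{\mathbb{R}\setminus\{0\}}(e^{tx}-1-tx)\,\nu(dx)\in[0,\infty]$, and $V=a+\int x^2\,\nu(dx)$. $\tau=\sup\{t>0:K_X(t)<\infty\}\in[0,\infty]$ (with $\sup\emptyset=0$). Let $H_X(dx)=a\delta_0(dx)+x^2\nu(dx)$ (total mass $V$), let $Z$ have law $H_X/V$, let $B\sim\mathrm{Beta}(1,2)$ (density $2(1-b)$ on $(0,1)$) be independent of $Z$, and put $R=BZ$, $M_R(t)=\mathbb{E}e^{tR}\in(0,\infty]$. $\Psi_1(t)=\frac1t\bigl(1-\frac{1}{M_R(t)}\bigr)$ for $t>0$. Conventions: $1/0=\infty$, $1/\infty=0$. With $\kappa_n$ the $n$-th cumulant of $X$ (when it exists): $m_1=\mathbb{E}R=\frac{\kappa_3}{3V}$, $m_2=\mathbb{E}R^2=\frac{\kappa_4}{6V}$, $m_3=\mathbb{E}R^3=\frac{\kappa_5}{10V}$, $\kappa=m_1^2-\frac{m_2}{2}$, $\gamma=m_1m_2-m_1^3-\frac{m_3}{6}$. A pair $(v,c)\in(0,\infty)\times[0,\infty)$ is feasible for $X$ if $K_X(t)\le \frac{vt^2}{2(1-ct)}$ for every $0\le t<1/c$ (for $c=0$: for all $t\ge0$).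 $c_*(v)=\inf\{c\ge0:(v,c)\text{ is feasible}\}\in[0,\infty]$, with $\inf\emptyset=\infty$. For $x>0$, $y_*(x)=\inf_{v\ge V}\{\sqrt{2vx}+c_*(v)\,x\}$. *)

theory Defs
  imports "HOL-Probability.Probability"
begin

definition infinitely_divisible :: "real measure \<Rightarrow> bool" where
  "infinitely_divisible \<mu> \<longleftrightarrow>
     (\<forall>n::nat. 0 < n \<longrightarrow> (\<exists>\<rho>. real_distribution \<rho> \<and>
        \<mu> = distr (\<Pi>\<^sub>M i\<in>{..<n}. \<rho>) borel (\<lambda>x. \<Sum>i<n. x i)))"

text \<open>A measure on the punctured line is represented by a Borel measure on the whole line
  that does not charge \<open>0\<close>.\<close>

definition levy_measure :: "real measure \<Rightarrow> bool" where
  "levy_measure \<nu> \<longleftrightarrow> sets \<nu> = sets borel \<and> emeasure \<nu> {0} = 0 \<and>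
     (\<integral>\<^sup>+x. ennreal (min 1 (x\<^sup>2)) \<partial>\<nu>) < \<infinity>"

text \<open>The L\'evy--Khintchine representation with truncation to \<open>[-1, 1]\<close>. Only the drift \<open>\<beta>\<close>
  depends on the choice of the truncation.\<close>

definition levy_triplet :: "real measure \<Rightarrow> real \<Rightarrow> real \<Rightarrow> real measure \<Rightarrow> bool" where
  "levy_triplet \<mu> \<beta> a \<nu> \<longleftrightarrow> 0 \<le> a \<and> levy_measure \<nu> \<and>
     (\<forall>t. char \<mu> t =
        exp (\<i> * of_real (t * \<beta>) - of_real (a * t\<^sup>2 / 2)
          + (CLINT x|\<nu>. iexp (t * x) - 1 - \<i> * of_real (t * x * indicator {-1..1} x))))"

definition cgf :: "'a measure \<Rightarrow> ('a \<Rightarrow> real) \<Rightarrow> real \<Rightarrow> ereal" where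
  "cgf M X t =
     (if integrable M (\<lambda>\<omega>. exp (t * X \<omega>)) then ereal (ln (LINT \<omega>|M. exp (t * X \<omega>))) else \<infinity>)"

text \<open>The element \<open>0\<close> is inserted because the supremum of the empty set is \<open>-\<infinity>\<close> in
  \<^typ>\<open>ereal\<close>.\<close>

definition exp_abscissa :: "'a measure \<Rightarrow> ('a \<Rightarrow> real) \<Rightarrow> ereal" where
  "exp_abscissa M X = Sup (insert 0 {ereal t | t. 0 < t \<and> cgf M X t < \<infinity>})"

definition jump_measure :: "real \<Rightarrow> real measure \<Rightarrow> real measure" where
  "jump_measure a \<nu> = measure_of UNIV (sets borel)
     (\<lambda>A. ennreal a * indicator A 0 + (\<integral>\<^sup>+x\<in>A. ennreal (x\<^sup>2) \<partial>\<nu>))"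

lemma emeasure_jump_measure:
  assumes "sets \<nu> = sets borel" and "A \<in> sets borel"
  shows "emeasure (jump_measure a \<nu>) A =
           ennreal a * indicator A 0 + (\<integral>\<^sup>+x\<in>A. ennreal (x\<^sup>2) \<partial>\<nu>)"
proof -
  define P where "P = density (return borel (0::real)) (\<lambda>_. ennreal a)"
  define Q where "Q = density \<nu> (\<lambda>x. ennreal (x\<^sup>2))"
  note [measurable_cong] = assms(1)
  have P: "emeasure P B = ennreal a * indicator B 0" if "B \<in> sets borel" for B
    unfolding P_def using that by (subst emeasure_density) (auto simp: nn_integral_cmult_indicator)
  have Q: "emeasure Q B = (\<integral>\<^sup>+x\<in>B. ennreal (x\<^sup>2) \<partial>\<nu>)" if "B \<in> sets borel" for B
    unfolding Q_def using that assms(1) by (subst emeasure_density) auto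
  have "countably_additive (sets borel)
          (\<lambda>B. ennreal a * indicator B (0::real) + (\<integral>\<^sup>+x\<in>B. ennreal (x\<^sup>2) \<partial>\<nu>))"
    unfolding countably_additive_def
  proof (intro allI impI)
    fix B :: "nat \<Rightarrow> real set"
    assume B: "range B \<subseteq> sets borel" "disjoint_family B" "\<Union>(range B) \<in> sets borel"
    have sP: "sets P = sets borel" and sQ: "sets Q = sets borel"
      by (simp_all add: P_def Q_def assms(1))
    have "(\<Sum>i. emeasure P (B i) + emeasure Q (B i)) =
            emeasure P (\<Union>(range B)) + emeasure Q (\<Union>(range B))"
      using B by (subst suminf_add[symmetric]) (auto simp: suminf_emeasure sP sQ)
    thus "(\<Sum>i. ennreal a * indicator (B i) 0 + (\<integral>\<^sup>+x\<in>B i. ennreal (x\<^sup>2) \<partial>\<nu>)) =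
            ennreal a * indicator (\<Union>(range B)) 0 + (\<integral>\<^sup>+x\<in>\<Union>(range B). ennreal (x\<^sup>2) \<partial>\<nu>)"
      using B P Q by (auto simp: subset_eq)
  qed
  moreover have "positive (sets borel)
          (\<lambda>B. ennreal a * indicator B (0::real) + (\<integral>\<^sup>+x\<in>B. ennreal (x\<^sup>2) \<partial>\<nu>))"
    by (simp add: positive_def)
  moreover have "sigma_algebra UNIV (sets (borel :: real measure))"
    using sets.sigma_algebra_axioms[of "borel :: real measure"] by simp
  ultimately show ?thesis
    unfolding jump_measure_def using assms(2)
    by (intro emeasure_measure_of_sigma)
qed

definition beta_1_2 :: "real measure" where
  "beta_1_2 = density lborel (\<lambda>b. ennreal (2 * (1 - b)) * indicator {0<..<1} b)"

text \<open>The law of \<open>R = B Z\<close> for independent \<open>B\<close> and \<open>Z\<close>, where \<open>B\<close> has law \<open>Beta(1, 2)\<close> and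
  \<open>Z\<close> has law \<^term>\<open>jump_measure a \<nu>\<close> divided by \<open>V\<close>. It is a probability measure if \<open>V\<close> is
  the total mass of \<^term>\<open>jump_measure a \<nu>\<close>.\<close>

definition law_R :: "real \<Rightarrow> real \<Rightarrow> real measure \<Rightarrow> real measure" where
  "law_R V a \<nu> =
     distr (beta_1_2 \<Otimes>\<^sub>M scale_measure (ennreal (1 / V)) (jump_measure a \<nu>)) borel (\<lambda>(b, z). b * z)"

definition mgf_R :: "real \<Rightarrow> real \<Rightarrow> real measure \<Rightarrow> real \<Rightarrow> ennreal" where
  "mgf_R V a \<nu> t = (\<integral>\<^sup>+r. ennreal (exp (t * r)) \<partial>law_R V a \<nu>)"

text \<open>In \<^typ>\<open>ennreal\<close>, \<open>1 / \<infinity> = 0\<close>.\<close>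

definition Psi1 :: "real \<Rightarrow> real \<Rightarrow> real measure \<Rightarrow> real \<Rightarrow> real" where
  "Psi1 V a \<nu> t = 1 / t * (1 - enn2real (1 / mgf_R V a \<nu> t))"

definition moment_R :: "real \<Rightarrow> real \<Rightarrow> real measure \<Rightarrow> nat \<Rightarrow> real" where
  "moment_R V a \<nu> k = (LINT r|law_R V a \<nu>. r ^ k)"

definition kappa_R :: "real \<Rightarrow> real \<Rightarrow> real measure \<Rightarrow> real" where
  "kappa_R V a \<nu> = (moment_R V a \<nu> 1)\<^sup>2 - moment_R V a \<nu> 2 / 2"

definition gamma_R :: "real \<Rightarrow> real \<Rightarrow> real measure \<Rightarrow> real" where
  "gamma_R V a \<nu> =
     moment_R V a \<nu> 1 * moment_R V a \<nu> 2 - (moment_R V a \<nu> 1) ^ 3 - moment_R V a \<nu> 3 / 6"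

definition feasible :: "'a measure \<Rightarrow> ('a \<Rightarrow> real) \<Rightarrow> real \<Rightarrow> real \<Rightarrow> bool" where
  "feasible M X v c \<longleftrightarrow> 0 < v \<and> 0 \<le> c \<and>
     (\<forall>t\<ge>0. (c = 0 \<or> t < 1 / c) \<longrightarrow> cgf M X t \<le> ereal (v * t\<^sup>2 / (2 * (1 - c * t))))"

definition c_star :: "'a measure \<Rightarrow> ('a \<Rightarrow> real) \<Rightarrow> real \<Rightarrow> ereal" where
  "c_star M X v = Inf {ereal c | c. 0 \<le> c \<and> feasible M X v c}"

definition y_star :: "'a measure \<Rightarrow> ('a \<Rightarrow> real) \<Rightarrow> real \<Rightarrow> ereal" where
  "y_star M X x =
     (INF v\<in>{prob_space.variance M X..}. ereal (sqrt (2 * v * x)) + c_star M X v * ereal x)"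

end

theory Submission
  imports Defs "HOL-Real_Asymp.Real_Asymp"
begin

text \<open>
  Write \<open>K\<close> for the cumulant generating function of \<open>X\<close>, \<open>M\<^sub>R\<close> for the moment generating function
  of \<open>R\<close> and \<open>m\<^sub>1\<close> for the mean of \<open>R\<close>.

  If \<open>c\<^sub>*\<close> has right derivative \<open>-\<infinity>\<close> at \<open>V\<close>, then a small increase of \<open>v\<close> above \<open>V\<close> lowers
  \<open>c\<^sub>*(v) x\<close> by more than any given multiple of \<open>v - V\<close>, whereas \<open>sqrt (2 v x)\<close> grows at most linearly;
  so some \<open>v > V\<close> beats \<open>V\<close> (\<open>y_star_less_if_derivative_MInf\<close>). Under boundary control, a feasible
  pair \<open>(v, c)\<close> makes \<open>K\<close> finite on \<open>[0, 1/c)\<close>, which forces \<open>c \<ge> 1/\<tau>\<close> whatever \<open>v\<close> is; hence \<open>c\<^sub>*\<close> is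
  smallest at \<open>V\<close>, and so are both summands in the infimum (\<open>y_star_eq_if_boundary\<close>).

  The derivative is \<open>-\<infinity>\<close> under (A) and under (B) for the same reason. The identity
  \<open>K(t) = V t\<^sup>2 / 2 \<cdot> M\<^sub>R(t)\<close> turns feasibility of \<open>(v, c)\<close> into \<open>(1 - c t) V / v \<le> 1 / M\<^sub>R(t)\<close> on \<open>[0, 1/c)\<close>.
  On the one hand, \<open>M\<^sub>R(t) \<ge> 1 + m\<^sub>1 t\<close> gives \<open>c\<^sub>*(V) \<ge> m\<^sub>1\<close>. On the other hand,
  \<open>g(t) = 1 / M\<^sub>R(t) - (1 - m\<^sub>1 t)\<close> is positive for \<open>t > 0\<close>, because \<open>\<Psi>\<^sub>1 < m\<^sub>1\<close>, and for
  \<open>c = m\<^sub>1 - N (v - V)\<close> the condition reads \<open>N (v - V) t \<le> (v - V) / v \<cdot> (1 - c t) + g(t)\<close>. The first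
  summand is enough for all \<open>t\<close> up to some \<open>t\<^sub>1\<close> that does not depend on \<open>v\<close>, and beyond \<open>t\<^sub>1\<close> the minimum of
  \<open>g\<close> over a compact interval is enough once \<open>v\<close> is close to \<open>V\<close>; the interval stays below \<open>\<tau>\<close>
  because \<open>m\<^sub>1 > 1/\<tau>\<close>. Hence \<open>c\<^sub>*(v) \<le> m\<^sub>1 - N (v - V)\<close> near \<open>V\<close> for every \<open>N\<close>
  (\<open>c_star_derivative_MInf\<close>).

  The identity for \<open>K\<close> has to be extracted from the L\'evy--Khintchine formula for the characteristic
  function \<open>exp \<psi>\<close>. Let \<open>\<rho>\<^sub>n\<close> be the \<open>n\<close>-th convolution root of the law of \<open>X\<close>. Then
  \<open>n (char \<rho>\<^sub>n - 1)\<close> tends to \<open>\<psi>\<close>. Taking second differences in the argument removes the drift and the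
  compensating term and multiplies the measures by \<open>2 (1 - cos (h x))\<close>; two incommensurable steps \<open>h\<close>
  give a weight that vanishes only at \<open>0\<close>. By L\'evy's continuity theorem the weighted measures
  \<open>n w \<rho>\<^sub>n\<close> converge weakly to the jump measure with density \<open>w(x) / x\<^sup>2\<close>. Finally
  \<open>n \<integral> (exp (t x) - 1 - t x) d\<rho>\<^sub>n\<close> tends to \<open>K(t)\<close>, and an exponential moment at some \<open>T > t\<close> together
  with the variance makes the integrands uniformly integrable, so that the limit can be taken under
  the integral (\<open>cgf_eq\<close>). Comparing the behaviour as \<open>t\<close> tends to \<open>0\<close> shows that the jump measure has mass \<open>V\<close>
  (\<open>total_jump_mass\<close>).
\<close>

section \<open>Two continuous kernels\<close>

text \<open>The value at \<open>0\<close> is the continuous extension. Twice this function is the moment generating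
  function of \<open>Beta(1, 2)\<close>, which is how the law of \<open>R\<close> enters.\<close>
definition exp_rem :: "real \<Rightarrow> real" where
  "exp_rem y = (if y = 0 then 1 / 2 else (exp y - 1 - y) / y\<^sup>2)"

lemma exp_rem_eq: "exp y - 1 - y = y\<^sup>2 * exp_rem y"
  by (simp add: exp_rem_def)

lemma exp_rem_nonneg: "0 \<le> exp_rem y"
proof -
  have "0 \<le> exp y - 1 - y"
    using exp_ge_add_one_self[of y] by linarith
  then show ?thesis
    by (simp add: exp_rem_def)
qed

lemma isCont_exp_rem: "isCont exp_rem y"
proof (cases "y = 0")
  case True
  have "((\<lambda>y::real. (exp y - 1 - y) / y\<^sup>2) \<longlongrightarrow> 1 / 2) (at 0)"
    by real_asymp
  moreover have "eventually (\<lambda>y. (exp y - 1 - y) / y\<^sup>2 = exp_rem y) (at 0)"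
    by (auto simp: exp_rem_def eventually_at_filter)
  ultimately have "(exp_rem \<longlongrightarrow> 1 / 2) (at 0)"
    by (rule Lim_transform_eventually)
  then show ?thesis
    by (simp add: True isCont_def exp_rem_def)
next
  case False
  have "isCont (\<lambda>y. (exp y - 1 - y) / y\<^sup>2) y"
    using False by (intro continuous_intros) auto
  moreover have "eventually (\<lambda>z. (exp z - 1 - z) / z\<^sup>2 = exp_rem z) (nhds y)"
    using t1_space_nhds[OF False] by eventually_elim (simp add: exp_rem_def)
  ultimately show ?thesis
    by (simp add: isCont_cong)
qed

lemma continuous_on_exp_rem [continuous_intros]:
  "continuous_on S f \<Longrightarrow> continuous_on S (\<lambda>x. exp_rem (f x))"
  using continuous_on_compose[of S f exp_rem, OF _ continuous_at_imp_continuous_on]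
  by (auto simp: o_def isCont_exp_rem)

lemma borel_measurable_exp_rem [measurable]: "exp_rem \<in> borel_measurable borel"
  by (intro borel_measurable_continuous_onI continuous_intros continuous_on_id)

text \<open>The weight that second differences with the steps \<open>1\<close> and \<open>sqrt 2\<close> produce. A single step would
  give a weight with a whole lattice of zeros, which would hide the jumps there; the
  incommensurability of the two steps leaves \<open>0\<close> as the only zero.\<close>
definition osc_weight :: "real \<Rightarrow> real" where
  "osc_weight x = 2 * (1 - cos x) + 2 * (1 - cos (sqrt 2 * x))"

text \<open>The continuous extension of \<open>osc_weight x / x\<^sup>2\<close>: since the jump measure carries the factor
  \<open>x\<^sup>2\<close>, it is this function that appears as a density against it.\<close>
definition osc_ratio :: "real \<Rightarrow> real" where
  "osc_ratio x = (sinc (x / 2))\<^sup>2 + 2 * (sinc (x / sqrt 2))\<^sup>2"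

lemma osc_weight_eq: "osc_weight x = x\<^sup>2 * osc_ratio x"
proof -
  have c: "2 * (1 - cos x) = 4 * (sin (x / 2))\<^sup>2" for x :: real
    using cos_double_sin[of "x / 2"] by simp
  have "sqrt 2 * x / 2 = x / sqrt 2"
    by (simp add: field_simps)
  then show ?thesis
    unfolding osc_weight_def osc_ratio_def c[of x] c[of "sqrt 2 * x"]
    by (simp add: power_divide distrib_left power_mult_distrib)
qed

lemma osc_weight_nonneg: "0 \<le> osc_weight x"
  and osc_weight_le: "osc_weight x \<le> 8"
proof -
  have *: "0 \<le> 2 * (1 - a) + 2 * (1 - b) \<and> 2 * (1 - a) + 2 * (1 - b) \<le> 8"
    if "- 1 \<le> a" "a \<le> 1" "- 1 \<le> b" "b \<le> 1" for a b :: real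
    using that by auto
  have "0 \<le> osc_weight x \<and> osc_weight x \<le> 8"
    unfolding osc_weight_def by (rule *) simp_all
  then show "0 \<le> osc_weight x" "osc_weight x \<le> 8"
    by simp_all
qed

lemma two_squares_irrational:
  fixes k l :: int assumes "l\<^sup>2 = 2 * k\<^sup>2" shows "k = 0"
proof (rule ccontr)
  assume k: "k \<noteq> 0"
  then have l: "l \<noteq> 0" using assms by auto
  have "multiplicity 2 (l\<^sup>2) = 2 * multiplicity 2 l"
    using l by (simp add: prime_elem_multiplicity_power_distrib)
  moreover have "multiplicity 2 (2 * k\<^sup>2) = 1 + 2 * multiplicity 2 k"
    using k by (subst prime_elem_multiplicity_mult_distrib)
      (auto simp: prime_elem_multiplicity_power_distrib)
  ultimately have "2 * multiplicity 2 l = 1 + 2 * multiplicity 2 k" using assms by metis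
  then show False by presburger
qed

lemma osc_ratio_pos: "0 < osc_ratio x"
proof (cases "x = 0")
  case True then show ?thesis by (simp add: osc_ratio_def)
next
  case False
  have "\<not> (sin (x / 2) = 0 \<and> sin (x / sqrt 2) = 0)"
  proof
    assume "sin (x / 2) = 0 \<and> sin (x / sqrt 2) = 0"
    then obtain k l :: int where kl: "x / 2 = k * pi" "x / sqrt 2 = l * pi"
      unfolding sin_zero_iff_int2 by auto
    then have "x = 2 * k * pi" "x = sqrt 2 * l * pi" by (auto simp: field_simps)
    then have "2 * k * pi = sqrt 2 * l * pi" by simp
    then have "2 * real_of_int k = sqrt 2 * l" by simp
    then have "(2 * real_of_int k)\<^sup>2 = (sqrt 2 * l)\<^sup>2" by simp
    then have "real_of_int (l\<^sup>2) = real_of_int (2 * k\<^sup>2)" by (simp add: power_mult_distrib)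
    then have "l\<^sup>2 = 2 * k\<^sup>2" by linarith
    then show False using two_squares_irrational False kl by auto
  qed
  with False have "sinc (x / 2) \<noteq> 0 \<or> sinc (x / sqrt 2) \<noteq> 0" by auto
  then show ?thesis
    unfolding osc_ratio_def
    by (elim disjE; intro add_pos_nonneg add_nonneg_pos) auto
qed

lemma continuous_on_osc_ratio [continuous_intros]:
  "continuous_on S f \<Longrightarrow> continuous_on S (\<lambda>x. osc_ratio (f x))"
  unfolding osc_ratio_def by (intro continuous_intros) auto

lemma borel_measurable_osc_ratio [measurable]: "osc_ratio \<in> borel_measurable borel"
  by (intro borel_measurable_continuous_onI continuous_intros continuous_on_id)

lemma borel_measurable_osc_weight [measurable]: "osc_weight \<in> borel_measurable borel"
  unfolding osc_weight_def by simp

text \<open>The domination behind uniform integrability. After cancelling the common denominator, the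
  compensated exponential at \<open>t\<close> is of smaller order than that at \<open>T\<close> plus \<open>x\<^sup>2\<close>: the exponential
  wins at \<open>+\<infinity>\<close>, and \<open>x\<^sup>2\<close> wins against the linear growth at \<open>-\<infinity>\<close>. On the compact rest,
  continuity gives the constant.\<close>
lemma exp_rem_dominated:
  fixes t T \<epsilon> :: real
  assumes t: "0 < t" "t < T" and \<epsilon>: "0 < \<epsilon>"
  shows "\<exists>D. \<forall>x. t\<^sup>2 * exp_rem (t * x) / osc_ratio x
                    \<le> \<epsilon> * ((T\<^sup>2 * exp_rem (T * x) + 1) / osc_ratio x) + D"
proof -
  define h where "h x = (exp (t * x) - 1 - t * x) / (exp (T * x) - 1 - T * x + x\<^sup>2)" for x
  have "0 < T" "0 < T - t" using t by auto
  have "(h \<longlongrightarrow> 0) at_top" unfolding h_def using t \<open>0 < T\<close> \<open>0 < T - t\<close> by real_asymp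
  moreover have "(h \<longlongrightarrow> 0) at_bot" unfolding h_def using t \<open>0 < T\<close> \<open>0 < T - t\<close> by real_asymp
  ultimately have "eventually (\<lambda>x. h x < \<epsilon>) at_top" "eventually (\<lambda>x. h x < \<epsilon>) at_bot"
    using \<epsilon> by (auto simp: order_tendsto_iff)
  then obtain m1 m2 where m: "\<And>x. m1 \<le> x \<Longrightarrow> h x < \<epsilon>" "\<And>x. x \<le> m2 \<Longrightarrow> h x < \<epsilon>"
    unfolding eventually_at_top_linorder eventually_at_bot_linorder by blast
  have cont: "continuous_on {m2..m1} (\<lambda>x. t\<^sup>2 * exp_rem (t * x) / osc_ratio x)"
    using osc_ratio_pos by (intro continuous_intros) (auto simp: less_imp_neq[symmetric])
  have "bounded ((\<lambda>x. t\<^sup>2 * exp_rem (t * x) / osc_ratio x) ` {m2..m1})"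
    by (intro compact_imp_bounded compact_continuous_image cont) auto
  then obtain D where D: "\<And>x. x \<in> {m2..m1} \<Longrightarrow> \<bar>t\<^sup>2 * exp_rem (t * x) / osc_ratio x\<bar> \<le> D"
    unfolding bounded_iff real_norm_def by blast
  \<comment> \<open>At \<open>x = 0\<close> the quotient \<open>h\<close> is \<open>0 / 0\<close>; the last summand takes care of that point.\<close>
  have "t\<^sup>2 * exp_rem (t * x) / osc_ratio x
          \<le> \<epsilon> * ((T\<^sup>2 * exp_rem (T * x) + 1) / osc_ratio x) + \<bar>D\<bar> + t\<^sup>2 * exp_rem 0 / osc_ratio 0" for x
  proof -
    have r: "0 \<le> \<epsilon> * ((T\<^sup>2 * exp_rem (T * x) + 1) / osc_ratio x)"
      using \<epsilon> osc_ratio_pos[of x] exp_rem_nonneg[of "T * x"] by simp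
    have z: "0 \<le> t\<^sup>2 * exp_rem 0 / osc_ratio 0"
      using osc_ratio_pos[of 0] exp_rem_nonneg[of 0] by simp
    consider "x = 0" | "x \<in> {m2..m1}" | "x \<noteq> 0" "h x < \<epsilon>"
      using m[of x] by force
    then show ?thesis
    proof cases
      case 1 then show ?thesis using r by simp
    next
      case 2 then show ?thesis using D[of x] r z by linarith
    next
      case 3
      have "0 < x\<^sup>2 * (T\<^sup>2 * exp_rem (T * x) + 1)"
        using 3 exp_rem_nonneg[of "T * x"] by (intro mult_pos_pos add_nonneg_pos) auto
      moreover have "h x = x\<^sup>2 * (t\<^sup>2 * exp_rem (t * x)) / (x\<^sup>2 * (T\<^sup>2 * exp_rem (T * x) + 1))"
        unfolding h_def exp_rem_eq by (simp add: power_mult_distrib algebra_simps)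
      moreover have "0 < T\<^sup>2 * exp_rem (T * x) + 1"
        using exp_rem_nonneg[of "T * x"] by (intro add_nonneg_pos) auto
      ultimately have "t\<^sup>2 * exp_rem (t * x) \<le> \<epsilon> * (T\<^sup>2 * exp_rem (T * x) + 1)"
        using 3 by (simp add: divide_less_eq)
      then have "t\<^sup>2 * exp_rem (t * x) / osc_ratio x \<le> \<epsilon> * (T\<^sup>2 * exp_rem (T * x) + 1) / osc_ratio x"
        using osc_ratio_pos[of x] by (intro divide_right_mono) auto
      then show ?thesis using z by (simp add: field_simps)
    qed
  qed
  then show ?thesis by (auto simp: add.assoc)
qed

section \<open>Sums of independent identically distributed variables\<close>

text \<open>The law \<open>\<mu>\<close> of a sum of \<open>n\<close> independent variables with law \<open>\<rho>\<close>: what a convolution root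
  inherits from \<open>\<mu>\<close>.\<close>
locale iid_sum = real_distribution \<rho> for \<rho> +
  fixes n :: nat and \<mu> :: "real measure"
  assumes n_pos: "0 < n"
    and sum_law: "\<mu> = distr (\<Pi>\<^sub>M i\<in>{..<n}. \<rho>) borel (\<lambda>x. \<Sum>i<n. x i)"
begin

sublocale product: product_prob_space "\<lambda>_. \<rho>" "{..<n}"
  by unfold_locales

abbreviation "P \<equiv> (\<Pi>\<^sub>M i\<in>{..<n}. \<rho>)"

lemma component_measurable: "i < n \<Longrightarrow> (\<lambda>x. x i) \<in> borel_measurable P"
  using measurable_component_singleton[of i "{..<n}" "\<lambda>_. \<rho>"]
  by (simp cong: measurable_cong_sets)

lemma sum_measurable [measurable]: "(\<lambda>x. \<Sum>i<n. x i) \<in> borel_measurable P"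
  by (intro borel_measurable_sum component_measurable) auto

lemma char_sum: "char \<mu> t = char \<rho> t ^ n"
proof -
  have "char \<mu> t = (CLINT x|P. (\<Prod>i<n. iexp (t * x i)))"
    unfolding char_def sum_law
    by (subst integral_distr) (auto simp: sum_distrib_left exp_sum)
  also have "\<dots> = (\<Prod>i<n. CLINT x|\<rho>. iexp (t * x))"
    by (intro product.product_integral_prod integrable_iexp) auto
  finally show ?thesis
    by (simp add: char_def)
qed

lemma mgf_sum: "(\<integral>\<^sup>+x. ennreal (exp (t * x)) \<partial>\<mu>) = (\<integral>\<^sup>+x. ennreal (exp (t * x)) \<partial>\<rho>) ^ n"
proof -
  have "(\<integral>\<^sup>+x. ennreal (exp (t * x)) \<partial>\<mu>) = (\<integral>\<^sup>+x. (\<Prod>i<n. ennreal (exp (t * x i))) \<partial>P)"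
    unfolding sum_law
    by (subst nn_integral_distr) (auto simp: sum_distrib_left exp_sum prod_ennreal)
  also have "\<dots> = (\<Prod>i<n. \<integral>\<^sup>+x. ennreal (exp (t * x)) \<partial>\<rho>)"
    by (intro product.product_nn_integral_prod) auto
  finally show ?thesis
    by simp
qed

text \<open>By Fubini, finiteness of the second moment of the sum gives a value \<open>s\<close> of the sum of the other
  summands for which \<open>(s + y)\<^sup>2\<close> is integrable in the last summand \<open>y\<close>; a shift does not affect
  square integrability.\<close>
lemma square_integrable_summand:
  assumes "integrable \<mu> (\<lambda>x. x\<^sup>2)"
  shows "integrable \<rho> (\<lambda>x. x\<^sup>2)"
proof -
  obtain m where m: "n = Suc m"
    using n_pos by (cases n) auto
  interpret Q: prob_space "\<Pi>\<^sub>M i\<in>{..<m}. \<rho>"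
    by (intro prob_space_PiM) (rule prob_space_axioms)
  have [measurable]: "(\<lambda>x. \<Sum>i<m. x i) \<in> borel_measurable (\<Pi>\<^sub>M i\<in>{..<m}. \<rho>)"
    using measurable_component_singleton[of _ "{..<m}" "\<lambda>_. \<rho>"]
    by (intro borel_measurable_sum) (simp cong: measurable_cong_sets)
  have "(\<integral>\<^sup>+x. \<integral>\<^sup>+y. ennreal (((\<Sum>i<m. x i) + y)\<^sup>2) \<partial>\<rho> \<partial>(\<Pi>\<^sub>M i\<in>{..<m}. \<rho>))
      = (\<integral>\<^sup>+x. ennreal ((\<Sum>i<n. x i)\<^sup>2) \<partial>P)"
  proof -
    have "(\<integral>\<^sup>+x. ennreal ((\<Sum>i<n. x i)\<^sup>2) \<partial>(\<Pi>\<^sub>M i\<in>insert m {..<m}. \<rho>))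
        = (\<integral>\<^sup>+x. \<integral>\<^sup>+y. ennreal ((\<Sum>i<n. (x(m := y)) i)\<^sup>2) \<partial>\<rho> \<partial>(\<Pi>\<^sub>M i\<in>{..<m}. \<rho>))"
      using sum_measurable m
      by (intro product.product_nn_integral_insert) (auto simp: lessThan_Suc)
    moreover have "(\<Sum>i<n. (x(m := y)) i) = (\<Sum>i<m. x i) + y" for x :: "nat \<Rightarrow> real" and y
      unfolding m by simp
    ultimately show ?thesis
      by (simp add: m lessThan_Suc add.commute)
  qed
  also have "\<dots> = (\<integral>\<^sup>+x. ennreal (x\<^sup>2) \<partial>\<mu>)"
    unfolding sum_law by (subst nn_integral_distr) auto
  also have "\<dots> < \<infinity>"
    using assms by (simp add: integrable_iff_bounded)
  finally have "AE x in \<Pi>\<^sub>M i\<in>{..<m}. \<rho>. (\<integral>\<^sup>+y. ennreal (((\<Sum>i<m. x i) + y)\<^sup>2) \<partial>\<rho>) \<noteq> \<infinity>"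
    by (intro nn_integral_PInf_AE) (auto simp: less_top)
  then obtain s where s: "(\<integral>\<^sup>+y. ennreal ((s + y)\<^sup>2) \<partial>\<rho>) \<noteq> \<infinity>"
    using Q.AE_contr[of "\<lambda>x. (\<integral>\<^sup>+y. ennreal (((\<Sum>i<m. x i) + y)\<^sup>2) \<partial>\<rho>) \<noteq> \<infinity>"] by auto
  then have int: "integrable \<rho> (\<lambda>y. (s + y)\<^sup>2)"
    by (auto simp: integrable_iff_bounded less_top)
  have "y\<^sup>2 \<le> 2 * (s + y)\<^sup>2 + 2 * s\<^sup>2" for y
    using zero_le_power2[of "2 * s + y"] by (simp add: power2_eq_square algebra_simps)
  then have bound: "norm (y\<^sup>2) \<le> norm (2 * (s + y)\<^sup>2 + 2 * s\<^sup>2)" for y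
    using order_trans[OF _ abs_ge_self] by simp
  show ?thesis
  proof (rule Bochner_Integration.integrable_bound)
    show "integrable \<rho> (\<lambda>y. 2 * (s + y)\<^sup>2 + 2 * s\<^sup>2)"
      by (intro Bochner_Integration.integrable_add integrable_mult_right int integrable_const)
    show "(\<lambda>y. y\<^sup>2) \<in> borel_measurable \<rho>"
      by measurable
    show "AE y in \<rho>. norm (y\<^sup>2) \<le> norm (2 * (s + y)\<^sup>2 + 2 * s\<^sup>2)"
      by (intro AE_I2 bound)
  qed
qed

text \<open>Independence makes the mixed moments of distinct summands products of means, which vanish, so
  that the variance of the sum is additive.\<close>
lemma moments_summand:
  assumes sq: "integrable \<mu> (\<lambda>x. x\<^sup>2)" and mean: "(\<integral>x. x \<partial>\<mu>) = 0"
  shows "integrable \<rho> (\<lambda>x. x)" "(\<integral>x. x \<partial>\<rho>) = 0" "(\<integral>x. x\<^sup>2 \<partial>\<mu>) = n * (\<integral>x. x\<^sup>2 \<partial>\<rho>)"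
proof -
  note sq\<rho> = square_integrable_summand[OF sq]
  show int: "integrable \<rho> (\<lambda>x. x)"
    by (rule square_integrable_imp_integrable[OF _ sq\<rho>]) auto
  have component: "distr P \<rho> (\<lambda>x. x i) = \<rho>" if "i < n" for i
    using that by (intro distr_PiM_component) (auto intro: prob_space_axioms)
  have meas: "(\<lambda>x. x i) \<in> measurable P \<rho>" if "i < n" for i
    using that by (intro measurable_component_singleton) auto
  have int_comp: "integrable P (\<lambda>x. f (x i))" "(\<integral>x. f (x i) \<partial>P) = (\<integral>x. f x \<partial>\<rho>)"
    if "i < n" "integrable \<rho> f" for i and f :: "real \<Rightarrow> real"
    using that meas[of i] component[of i]
      integrable_distr_eq[of "\<lambda>x. x i" P \<rho> f] integral_distr[of "\<lambda>x. x i" P \<rho> f] by auto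
  have "(\<integral>x. x \<partial>\<mu>) = (\<integral>x. (\<Sum>i<n. x i) \<partial>P)"
    unfolding sum_law by (subst integral_distr) auto
  also have "\<dots> = n * (\<integral>x. x \<partial>\<rho>)"
    using int_comp[OF _ int] by (subst Bochner_Integration.integral_sum) auto
  finally show mean\<rho>: "(\<integral>x. x \<partial>\<rho>) = 0"
    using mean n_pos by simp
  have int2: "integrable P (\<lambda>x. x i * x j)" if "i < n" "j < n" for i j
  proof (rule Bochner_Integration.integrable_bound)
    show "integrable P (\<lambda>x. (x i)\<^sup>2 + (x j)\<^sup>2)"
      using int_comp(1)[OF _ sq\<rho>] that by auto
    show "(\<lambda>x. x i * x j) \<in> borel_measurable P"
      using component_measurable that by auto
    have "\<bar>a * b\<bar> \<le> a\<^sup>2 + b\<^sup>2" for a b :: real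
    proof -
      have "2 * \<bar>a * b\<bar> \<le> a\<^sup>2 + b\<^sup>2"
        using sum_squares_bound[of "\<bar>a\<bar>" "\<bar>b\<bar>"] by (simp add: abs_mult)
      then show ?thesis
        using abs_ge_zero[of "a * b"] by linarith
    qed
    then show "AE x in P. norm (x i * x j) \<le> norm ((x i)\<^sup>2 + (x j)\<^sup>2)"
      by (auto intro: order_trans[OF _ abs_ge_self])
  qed
  have cross: "(\<integral>x. x i * x j \<partial>P) = (if i = j then \<integral>x. x\<^sup>2 \<partial>\<rho> else 0)" if ij: "i < n" "j < n" for i j
  proof (cases "i = j")
    case True
    then show ?thesis
      using int_comp(2)[OF _ sq\<rho>, of i] ij by (simp add: power2_eq_square)
  next
    case False
    \<comment> \<open>The mixed product is written as a product over all coordinates, so that the product rule applies.\<close>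
    define f where "f k y = (if k = i then y else 1) * (if k = j then y else 1)" for k :: nat and y :: real
    have int_f: "integrable \<rho> (f k)" for k
      using False int unfolding f_def by (cases "k = i"; cases "k = j") auto
    have "(\<integral>x. x i * x j \<partial>P) = (\<integral>x. (\<Prod>k<n. f k (x k)) \<partial>P)"
      unfolding f_def prod.distrib using ij by (simp add: prod.delta)
    also have "\<dots> = (\<Prod>k<n. \<integral>x. f k x \<partial>\<rho>)"
      using int_f by (intro product.product_integral_prod) auto
    also have "\<dots> = 0"
      using ij False mean\<rho> by (intro prod_zero bexI[of _ i]) (auto simp: f_def)
    finally show ?thesis
      using False by simp
  qed
  have "(\<integral>x. x\<^sup>2 \<partial>\<mu>) = (\<integral>x. (\<Sum>i<n. x i)\<^sup>2 \<partial>P)"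
    unfolding sum_law by (subst integral_distr) auto
  also have "\<dots> = (\<integral>x. (\<Sum>i<n. \<Sum>j<n. x i * x j) \<partial>P)"
    by (simp add: power2_eq_square sum_product)
  also have "\<dots> = (\<Sum>i<n. \<Sum>j<n. \<integral>x. x i * x j \<partial>P)"
    using int2 by (subst Bochner_Integration.integral_sum, auto)+
  also have "\<dots> = (\<Sum>i<n. \<Sum>j<n. if i = j then \<integral>x. x\<^sup>2 \<partial>\<rho> else 0)"
    using cross by (intro sum.cong refl) auto
  also have "\<dots> = n * (\<integral>x. x\<^sup>2 \<partial>\<rho>)"
    by (simp add: sum.delta)
  finally show "(\<integral>x. x\<^sup>2 \<partial>\<mu>) = n * (\<integral>x. x\<^sup>2 \<partial>\<rho>)" .
qed

end

section \<open>The exponent of the characteristic function\<close>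

definition levy_kernel :: "real \<Rightarrow> real \<Rightarrow> complex" where
  "levy_kernel t x = iexp (t * x) - 1 - \<i> * of_real (t * x * indicator {-1..1} x)"

definition levy_exponent :: "real \<Rightarrow> real \<Rightarrow> real measure \<Rightarrow> real \<Rightarrow> complex" where
  "levy_exponent \<beta> a \<nu> t =
     \<i> * of_real (t * \<beta>) - of_real (a * t\<^sup>2 / 2) + (CLINT x|\<nu>. levy_kernel t x)"

text \<open>Taylor's formula near \<open>0\<close> and the trivial bound elsewhere; the right-hand side is integrable against
  a L\'evy measure, locally uniformly in \<open>t\<close>.\<close>
lemma levy_kernel_bound: "norm (levy_kernel t x) \<le> (2 + t\<^sup>2) * min 1 (x\<^sup>2)"
proof (cases "\<bar>x\<bar> \<le> 1")
  case True
  then have ind: "indicator {-1..1} x = (1::real)" and "x\<^sup>2 \<le> 1"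
    by (auto simp: abs_le_iff abs_square_le_1)
  have "norm (levy_kernel t x) \<le> (t * x)\<^sup>2 / 2"
    using iexp_approx1[of "t * x" 1] ind
    by (simp add: levy_kernel_def algebra_simps numeral_2_eq_2)
  also have "\<dots> \<le> (2 + t\<^sup>2) * x\<^sup>2"
    by (simp add: power_mult_distrib algebra_simps add_nonneg_nonneg)
  finally show ?thesis
    using \<open>x\<^sup>2 \<le> 1\<close> by (simp add: min_def)
next
  case False
  then have ind: "indicator {-1..1} x = (0::real)" and "1 \<le> x\<^sup>2"
    using abs_square_le_1[of x] by (auto simp: abs_le_iff)
  have "norm (levy_kernel t x) \<le> norm (iexp (t * x)) + norm (1::complex)"
    unfolding levy_kernel_def ind using norm_triangle_ineq4[of "iexp (t * x)" 1] by simp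
  also have "\<dots> \<le> 2 + t\<^sup>2"
    by simp
  finally show ?thesis
    using \<open>1 \<le> x\<^sup>2\<close> by (simp add: min_def)
qed

lemma levy_kernel_measurable [measurable]: "levy_kernel t \<in> borel_measurable borel"
  unfolding levy_kernel_def by measurable

lemma integrable_min_levy:
  assumes "levy_measure \<nu>"
  shows "integrable \<nu> (\<lambda>x. min 1 (x\<^sup>2))"
proof -
  have [measurable_cong]: "sets \<nu> = sets borel"
    using assms by (simp add: levy_measure_def)
  show ?thesis
    using assms by (intro integrableI_bounded) (auto simp: levy_measure_def)
qed

lemma integrable_levy_kernel:
  assumes "levy_measure \<nu>"
  shows "integrable \<nu> (levy_kernel t)"
proof (rule Bochner_Integration.integrable_bound)
  have [measurable_cong]: "sets \<nu> = sets borel"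
    using assms by (simp add: levy_measure_def)
  show "integrable \<nu> (\<lambda>x. (2 + t\<^sup>2) * min 1 (x\<^sup>2))"
    using integrable_min_levy[OF assms] by simp
  show "levy_kernel t \<in> borel_measurable \<nu>"
    by measurable
  show "AE x in \<nu>. norm (levy_kernel t x) \<le> norm ((2 + t\<^sup>2) * min 1 (x\<^sup>2))"
    by (intro AE_I2 order_trans[OF levy_kernel_bound]) simp
qed

lemma isCont_levy_exponent:
  assumes "levy_measure \<nu>"
  shows "isCont (levy_exponent \<beta> a \<nu>) t"
proof -
  have [measurable_cong]: "sets \<nu> = sets borel"
    using assms by (simp add: levy_measure_def)
  have "isCont (\<lambda>t. CLINT x|\<nu>. levy_kernel t x) t"
    unfolding continuous_at_sequentially
  proof (intro allI impI)
    fix s :: "nat \<Rightarrow> real" assume s: "s \<longlonglongrightarrow> t"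
    then have "Bseq s"
      by (intro convergent_imp_Bseq convergentI)
    then obtain B where B: "\<And>n. norm (s n) \<le> B"
      unfolding Bseq_def by blast
    show "((\<lambda>t. CLINT x|\<nu>. levy_kernel t x) \<circ> s) \<longlonglongrightarrow> (CLINT x|\<nu>. levy_kernel t x)"
      unfolding comp_def
    proof (rule integral_dominated_convergence)
      show "integrable \<nu> (\<lambda>x. (2 + B\<^sup>2) * min 1 (x\<^sup>2))"
        using integrable_min_levy[OF assms] by simp
      show "AE x in \<nu>. (\<lambda>n. levy_kernel (s n) x) \<longlonglongrightarrow> levy_kernel t x"
        unfolding levy_kernel_def by (intro AE_I2 tendsto_intros s)
      show "AE x in \<nu>. norm (levy_kernel (s n) x) \<le> (2 + B\<^sup>2) * min 1 (x\<^sup>2)" for n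
      proof (intro AE_I2 order_trans[OF levy_kernel_bound] mult_right_mono)
        show "2 + (s n)\<^sup>2 \<le> 2 + B\<^sup>2"
          using power_mono[OF B[of n] norm_ge_zero, of 2] by simp
      qed simp
    qed measurable
  qed
  then show ?thesis
    unfolding levy_exponent_def by (intro continuous_intros) auto
qed

lemma levy_exponent_0 [simp]: "levy_exponent \<beta> a \<nu> 0 = 0"
  by (simp add: levy_exponent_def levy_kernel_def)

lemma second_difference_iexp:
  "2 * iexp (s * x) - iexp ((s + h) * x) - iexp ((s - h) * x)
     = of_real (2 * (1 - cos (h * x))) * iexp (s * x)"
proof -
  have "iexp (h * x) + iexp (- (h * x)) = of_real (2 * cos (h * x))"
    unfolding cis_conv_exp[symmetric] by (simp add: complex_eq_iff)
  moreover have "iexp ((s + h) * x) = iexp (s * x) * iexp (h * x)"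
    and "iexp ((s - h) * x) = iexp (s * x) * iexp (- (h * x))"
    by (simp_all add: exp_add[symmetric] algebra_simps)
  ultimately have "iexp ((s + h) * x) + iexp ((s - h) * x) = iexp (s * x) * of_real (2 * cos (h * x))"
    by (metis distrib_left)
  then show ?thesis
    by (simp add: algebra_simps)
qed

text \<open>The terms that are linear in the argument, namely drift and compensator, cancel in a second
  difference. What remains is the Fourier transform of a finite measure.\<close>
lemma second_difference_levy_exponent:
  assumes "levy_measure \<nu>"
  shows "integrable \<nu> (\<lambda>x. of_real (2 * (1 - cos (h * x))) * iexp (s * x))"
    and "2 * levy_exponent \<beta> a \<nu> s - levy_exponent \<beta> a \<nu> (s + h) - levy_exponent \<beta> a \<nu> (s - h)
      = of_real (a * h\<^sup>2) + (CLINT x|\<nu>. of_real (2 * (1 - cos (h * x))) * iexp (s * x))"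
proof -
  note int = integrable_levy_kernel[OF assms]
  have eq: "of_real (2 * (1 - cos (h * x))) * iexp (s * x)
      = 2 * levy_kernel s x - levy_kernel (s + h) x - levy_kernel (s - h) x" for x
    unfolding second_difference_iexp[symmetric] levy_kernel_def
    by (simp add: algebra_simps del: of_real_mult)
  show "integrable \<nu> (\<lambda>x. of_real (2 * (1 - cos (h * x))) * iexp (s * x))"
    unfolding eq by (intro Bochner_Integration.integrable_diff integrable_mult_right int)
  have "(CLINT x|\<nu>. of_real (2 * (1 - cos (h * x))) * iexp (s * x))
      = 2 * (CLINT x|\<nu>. levy_kernel s x) - (CLINT x|\<nu>. levy_kernel (s + h) x)
          - (CLINT x|\<nu>. levy_kernel (s - h) x)"
    unfolding eq by (simp add: int)
  then show "2 * levy_exponent \<beta> a \<nu> s - levy_exponent \<beta> a \<nu> (s + h) - levy_exponent \<beta> a \<nu> (s - h)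
      = of_real (a * h\<^sup>2) + (CLINT x|\<nu>. of_real (2 * (1 - cos (h * x))) * iexp (s * x))"
    unfolding levy_exponent_def
    by (simp add: algebra_simps power2_eq_square add_divide_distrib diff_divide_distrib)
qed

section \<open>The weighted jump measure\<close>

lemma sets_jump_measure [simp, measurable_cong]: "sets (jump_measure a \<nu>) = sets borel"
  unfolding jump_measure_def
  by (metis sets.sigma_sets_eq sets_measure_of sets.space_closed space_borel)

lemma space_jump_measure [simp]: "space (jump_measure a \<nu>) = UNIV"
  using sets_eq_imp_space_eq[OF sets_jump_measure] by simp

text \<open>Splitting off the atom at \<open>0\<close>, which carries the Gaussian variance, reduces integrals
  against the jump measure to integrals against the L\'evy measure.\<close>
lemma density_jump_measure_punctured:
  assumes "sets \<nu> = sets borel"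
  shows "density (jump_measure a \<nu>) (\<lambda>x. ennreal (indicator (- {0}) x)) = density \<nu> (\<lambda>x. ennreal (x\<^sup>2))"
proof (rule measure_eqI)
  note [measurable_cong] = assms
  fix A assume "A \<in> sets (density (jump_measure a \<nu>) (\<lambda>x. ennreal (indicator (- {0}) x)))"
  then have A[measurable]: "A \<in> sets borel"
    by simp
  have "emeasure (density (jump_measure a \<nu>) (\<lambda>x. ennreal (indicator (- {0}) x))) A
      = (\<integral>\<^sup>+x\<in>A. ennreal (indicator (- {0}) x) \<partial>jump_measure a \<nu>)"
    by (rule emeasure_density) auto
  also have "\<dots> = (\<integral>\<^sup>+x. indicator (A - {0}) x \<partial>jump_measure a \<nu>)"
    by (intro nn_integral_cong) (simp split: split_indicator)
  also have "\<dots> = emeasure (jump_measure a \<nu>) (A - {0})"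
    by (rule nn_integral_indicator) simp
  also have "\<dots> = (\<integral>\<^sup>+x\<in>A - {0}. ennreal (x\<^sup>2) \<partial>\<nu>)"
    by (simp add: emeasure_jump_measure assms)
  also have "\<dots> = emeasure (density \<nu> (\<lambda>x. ennreal (x\<^sup>2))) A"
    by (subst emeasure_density) (auto intro!: nn_integral_cong split: split_indicator)
  finally show "emeasure (density (jump_measure a \<nu>) (\<lambda>x. ennreal (indicator (- {0}) x))) A
      = emeasure (density \<nu> (\<lambda>x. ennreal (x\<^sup>2))) A" .
qed (simp add: assms)

lemma integral_jump_measure:
  fixes f :: "real \<Rightarrow> 'b::{banach, second_countable_topology}"
  assumes "sets \<nu> = sets borel" "0 \<le> a" and [measurable]: "f \<in> borel_measurable borel"
    and int: "integrable \<nu> (\<lambda>x. x\<^sup>2 *\<^sub>R f x)"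
  shows "integrable (jump_measure a \<nu>) f"
    and "integral\<^sup>L (jump_measure a \<nu>) f = a *\<^sub>R f 0 + (\<integral>x. x\<^sup>2 *\<^sub>R f x \<partial>\<nu>)"
proof -
  note [measurable_cong] = assms(1)
  have "integrable (density \<nu> (\<lambda>x. ennreal (x\<^sup>2))) f"
    using int by (subst integrable_density) auto
  then have off: "integrable (jump_measure a \<nu>) (\<lambda>x. indicator (- {0}) x *\<^sub>R f x)"
    unfolding density_jump_measure_punctured[OF assms(1), of a, symmetric]
    by (subst (asm) integrable_density) auto
  have off_eq: "(\<integral>x. indicator (- {0}) x *\<^sub>R f x \<partial>jump_measure a \<nu>) = (\<integral>x. x\<^sup>2 *\<^sub>R f x \<partial>\<nu>)"
    using integral_density[of f "jump_measure a \<nu>" "indicator (- {0})"]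
      integral_density[of f \<nu> "\<lambda>x. x\<^sup>2"] density_jump_measure_punctured[OF assms(1), of a]
    by simp
  have atom: "emeasure (jump_measure a \<nu>) {0} = ennreal a"
  proof -
    have "(\<integral>\<^sup>+x\<in>{0}. ennreal (x\<^sup>2) \<partial>\<nu>) = (\<integral>\<^sup>+x. 0 \<partial>\<nu>)"
      by (intro nn_integral_cong) (auto split: split_indicator)
    then show ?thesis
      by (simp add: emeasure_jump_measure assms(1))
  qed
  then have at: "integrable (jump_measure a \<nu>) (\<lambda>x. indicator {0} x *\<^sub>R f 0)"
    by (intro integrable_scaleR_left integrable_real_indicator) auto
  have at_eq: "(\<integral>x. indicator {0} x *\<^sub>R f 0 \<partial>jump_measure a \<nu>) = a *\<^sub>R f 0"
    using atom assms(2) by (simp add: measure_def)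
  have split: "(\<lambda>x. indicator {0} x *\<^sub>R f 0 + indicator (- {0}) x *\<^sub>R f x) = f"
    by (auto split: split_indicator)
  have eq: "(\<integral>x. indicator {0} x *\<^sub>R f 0 + indicator (- {0}) x *\<^sub>R f x \<partial>jump_measure a \<nu>)
      = a *\<^sub>R f 0 + (\<integral>x. x\<^sup>2 *\<^sub>R f x \<partial>\<nu>)"
    using at_eq off_eq by (simp only: Bochner_Integration.integral_add[OF at off])
  show "integrable (jump_measure a \<nu>) f"
    using Bochner_Integration.integrable_add[OF at off] by (simp only: split)
  show "integral\<^sup>L (jump_measure a \<nu>) f = a *\<^sub>R f 0 + (\<integral>x. x\<^sup>2 *\<^sub>R f x \<partial>\<nu>)"
    using eq by (simp only: split)
qed

text \<open>Summing the second differences for the two steps expresses the Fourier transform of the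
  weighted jump measure through the exponent; the Gaussian part supplies the atom, with
  \<open>osc_ratio 0 = 1\<^sup>2 + (sqrt 2)\<^sup>2\<close>.\<close>
lemma fourier_osc_ratio:
  assumes "levy_measure \<nu>" "0 \<le> a"
  shows "integrable (jump_measure a \<nu>) (\<lambda>x. osc_ratio x *\<^sub>R iexp (s * x))"
    and "(CLINT x|jump_measure a \<nu>. osc_ratio x *\<^sub>R iexp (s * x))
      = (2 * levy_exponent \<beta> a \<nu> s - levy_exponent \<beta> a \<nu> (s + 1) - levy_exponent \<beta> a \<nu> (s - 1))
      + (2 * levy_exponent \<beta> a \<nu> s - levy_exponent \<beta> a \<nu> (s + sqrt 2) - levy_exponent \<beta> a \<nu> (s - sqrt 2))"
proof -
  have sets: "sets \<nu> = sets borel"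
    using assms by (simp add: levy_measure_def)
  note int = second_difference_levy_exponent(1)[OF assms(1), of _ s]
  have eq: "x\<^sup>2 *\<^sub>R (osc_ratio x *\<^sub>R iexp (s * x))
      = of_real (2 * (1 - cos (1 * x))) * iexp (s * x) + of_real (2 * (1 - cos (sqrt 2 * x))) * iexp (s * x)" for x
  proof -
    have "x\<^sup>2 *\<^sub>R (osc_ratio x *\<^sub>R iexp (s * x)) = of_real (osc_weight x) * iexp (s * x)"
      by (simp add: osc_weight_eq scaleR_conv_of_real)
    then show ?thesis
      unfolding osc_weight_def of_real_add distrib_right mult_1 .
  qed
  have int': "integrable \<nu> (\<lambda>x. x\<^sup>2 *\<^sub>R (osc_ratio x *\<^sub>R iexp (s * x)))"
    unfolding eq by (intro Bochner_Integration.integrable_add int)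
  show "integrable (jump_measure a \<nu>) (\<lambda>x. osc_ratio x *\<^sub>R iexp (s * x))"
    by (intro integral_jump_measure(1)[OF sets assms(2) _ int']) measurable
  have "(CLINT x|jump_measure a \<nu>. osc_ratio x *\<^sub>R iexp (s * x))
      = a *\<^sub>R (osc_ratio 0 *\<^sub>R iexp (s * 0)) + (CLINT x|\<nu>. x\<^sup>2 *\<^sub>R (osc_ratio x *\<^sub>R iexp (s * x)))"
    by (intro integral_jump_measure(2)[OF sets assms(2) _ int']) measurable
  also have "osc_ratio 0 = 3"
    by (simp add: osc_ratio_def)
  also have "(CLINT x|\<nu>. x\<^sup>2 *\<^sub>R (osc_ratio x *\<^sub>R iexp (s * x)))
      = (CLINT x|\<nu>. of_real (2 * (1 - cos (1 * x))) * iexp (s * x))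
      + (CLINT x|\<nu>. of_real (2 * (1 - cos (sqrt 2 * x))) * iexp (s * x))"
    unfolding eq by (intro Bochner_Integration.integral_add int)
  also have "a *\<^sub>R (3 *\<^sub>R iexp (s * 0)) = of_real (a * 1\<^sup>2) + of_real (a * (sqrt 2)\<^sup>2)"
    by (simp add: scaleR_conv_of_real)
  finally show "(CLINT x|jump_measure a \<nu>. osc_ratio x *\<^sub>R iexp (s * x))
      = (2 * levy_exponent \<beta> a \<nu> s - levy_exponent \<beta> a \<nu> (s + 1) - levy_exponent \<beta> a \<nu> (s - 1))
      + (2 * levy_exponent \<beta> a \<nu> s - levy_exponent \<beta> a \<nu> (s + sqrt 2) - levy_exponent \<beta> a \<nu> (s - sqrt 2))"
    unfolding second_difference_levy_exponent(2)[OF assms(1)] by simp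
qed

section \<open>Roots of an exponential\<close>

text \<open>The quotient of two continuous \<open>n\<close>-th roots takes values in the finite set of \<open>n\<close>-th roots of
  unity, so it is constant on the connected line.\<close>
lemma root_of_exp_unique:
  fixes f g :: "real \<Rightarrow> complex"
  assumes "0 < n" and f: "\<And>t. isCont f t" and g: "\<And>t. isCont g t"
    and pow: "\<And>t. f t ^ n = exp (g t)" and "f 0 = 1" "g 0 = 0"
  shows "f t = exp (g t / of_nat n)"
proof -
  define d where "d t = f t * exp (- (g t / of_nat n))" for t
  have "exp (- (g t / of_nat n)) ^ n = exp (- g t)" for t
    using exp_of_nat_mult[of n "- (g t / of_nat n)"] \<open>0 < n\<close> by simp
  then have "d t ^ n = 1" for t
    by (simp add: d_def power_mult_distrib pow mult_exp_exp)
  then have "range d \<subseteq> {z. z ^ n = 1}"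
    by auto
  then have "finite (range d)"
    using \<open>0 < n\<close> by (auto intro: finite_subset finite_roots_unity)
  moreover have "continuous_on UNIV d"
    unfolding d_def using f g \<open>0 < n\<close>
    by (intro continuous_at_imp_continuous_on ballI continuous_intros) auto
  ultimately have "d constant_on UNIV"
    by (intro continuous_finite_range_constant) auto
  then have "d t = d 0"
    by (auto simp: constant_on_def)
  also have "d 0 = 1"
    by (simp add: d_def assms)
  finally show ?thesis
    by (simp add: d_def exp_minus field_simps)
qed

lemma scaled_exp_limit:
  fixes z :: "'a :: {real_normed_field, banach}"
  shows "(\<lambda>n. of_nat (Suc n) * (exp (z / of_nat (Suc n)) - 1)) \<longlonglongrightarrow> z"
proof (cases "z = 0")
  case False
  have "(\<lambda>n. z / of_nat (Suc n)) \<longlonglongrightarrow> 0"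
    by (intro LIMSEQ_Suc lim_const_over_n)
  then have "filterlim (\<lambda>n. z / of_nat (Suc n)) (at 0) sequentially"
    using False by (auto simp: filterlim_at simp del: of_nat_Suc)
  moreover have "((\<lambda>h. (exp h - 1) / h) \<longlongrightarrow> (1::'a)) (at 0)"
    using DERIV_exp[of "0::'a"] by (simp add: DERIV_def)
  ultimately have "(\<lambda>n. (exp (z / of_nat (Suc n)) - 1) / (z / of_nat (Suc n))) \<longlonglongrightarrow> 1"
    by (rule filterlim_compose[rotated])
  then have "(\<lambda>n. z * ((exp (z / of_nat (Suc n)) - 1) / (z / of_nat (Suc n)))) \<longlonglongrightarrow> z * 1"
    by (intro tendsto_intros)
  moreover have "z * ((w - 1) / (z / of_nat (Suc n))) = of_nat (Suc n) * (w - 1)" for w :: 'a and n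
    using False by (simp del: of_nat_Suc)
  ultimately show ?thesis
    by (simp only: mult_1_right)
qed simp

section \<open>Weak convergence of finite measures\<close>

text \<open>L\'evy's continuity theorem for finite measures. The total masses converge because they are the
  values of the characteristic functions at \<open>0\<close>, so the measures can be normalised, unless the
  limiting mass is \<open>0\<close>; in that case all integrals of bounded functions tend to \<open>0\<close>.\<close>
lemma levy_continuity_finite:
  fixes f :: "real \<Rightarrow> real"
  assumes M: "\<And>n. finite_borel_measure (M n)" and M': "finite_borel_measure M'"
    and char: "\<And>t. (\<lambda>n. char (M n) t) \<longlonglongrightarrow> char M' t"
    and f: "\<And>x. isCont f x" "\<And>x. \<bar>f x\<bar> \<le> B"
  shows "(\<lambda>n. \<integral>x. f x \<partial>M n) \<longlonglongrightarrow> (\<integral>x. f x \<partial>M')"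
proof -
  interpret M: finite_borel_measure "M n" for n by (rule M)
  interpret M': finite_borel_measure M' by (rule M')
  note [measurable_cong] = M.M_is_borel M'.M_is_borel
  have space [simp]: "space (M n) = UNIV" "space M' = UNIV" for n
    using sets_eq_imp_space_eq[OF M.M_is_borel] sets_eq_imp_space_eq[OF M'.M_is_borel] by auto
  have f_meas [measurable]: "f \<in> borel_measurable borel"
    using f(1) by (intro borel_measurable_continuous_onI continuous_at_imp_continuous_on) auto
  have bound: "\<bar>\<integral>x. f x \<partial>N\<bar> \<le> B * measure N UNIV" if N: "finite_borel_measure N" for N
  proof -
    interpret N: finite_borel_measure N by (rule N)
    note [measurable_cong] = N.M_is_borel
    have sp: "space N = UNIV"
      using sets_eq_imp_space_eq[OF N.M_is_borel] by simp
    have "\<bar>\<integral>x. f x \<partial>N\<bar> \<le> (\<integral>x. \<bar>f x\<bar> \<partial>N)"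
      by (rule integral_abs_bound)
    also have "\<dots> \<le> (\<integral>x. B \<partial>N)"
    proof (rule integral_mono)
      show "integrable N (\<lambda>x. \<bar>f x\<bar>)"
        using f(2) by (intro N.integrable_const_bound[of _ B]) auto
    qed (auto simp: f(2))
    finally have "\<bar>\<integral>x. f x \<partial>N\<bar> \<le> (\<integral>x. B \<partial>N)" .
    then show ?thesis
      by (simp add: sp mult.commute)
  qed
  define m where "m n = measure (M n) UNIV" for n
  define m' where "m' = measure M' UNIV"
  have m: "m \<longlonglongrightarrow> m'"
  proof -
    have "char N 0 = of_real (measure N (space N))" for N
      by (simp add: char_def scaleR_conv_of_real)
    then have "(\<lambda>n. complex_of_real (m n)) \<longlonglongrightarrow> of_real m'"
      using char[of 0] by (simp add: m_def m'_def)
    then show ?thesis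
      by (simp add: tendsto_of_real_iff)
  qed
  show ?thesis
  proof (cases "m' = 0")
    case True
    then have "(\<integral>x. f x \<partial>M') = 0"
      using bound[OF M'] by (simp add: m'_def)
    moreover have "(\<lambda>n. \<integral>x. f x \<partial>M n) \<longlonglongrightarrow> 0"
    proof (rule Lim_null_comparison)
      show "eventually (\<lambda>n. norm (\<integral>x. f x \<partial>M n) \<le> B * m n) sequentially"
        using bound[OF M] by (simp add: m_def)
      show "(\<lambda>n. B * m n) \<longlonglongrightarrow> 0"
        using tendsto_mult_left[OF m, of B] True by simp
    qed
    ultimately show ?thesis
      by simp
  next
    case False
    then have pos': "0 < m'"
      by (simp add: m'_def zero_less_measure_iff)
    define normalise where "normalise N = density N (\<lambda>_. ennreal (1 / measure N UNIV))" for N :: "real measure"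
    have norm_dist: "real_distribution (normalise N)"
      if N: "finite_borel_measure N" "0 < measure N UNIV" for N
    proof -
      interpret N: finite_borel_measure N by (rule N)
      have sp: "space N = UNIV"
        using sets_eq_imp_space_eq[OF N.M_is_borel] by simp
      have "emeasure (normalise N) (space (normalise N)) = ennreal (1 / measure N UNIV) * emeasure N UNIV"
        using N.M_is_borel sp unfolding normalise_def by (subst emeasure_density_const) auto
      also have "\<dots> = 1"
        using N(2) by (simp add: N.emeasure_eq_measure ennreal_mult[symmetric])
      finally show ?thesis
        using N.M_is_borel by (intro real_distribution.intro prob_spaceI real_distribution_axioms.intro)
          (auto simp: normalise_def)
    qed
    have norm_int: "(\<integral>x. h x \<partial>normalise N) = (1 / measure N UNIV) *\<^sub>R (\<integral>x. h x \<partial>N)"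
      if "sets N = sets borel" "h \<in> borel_measurable borel" for N and h :: "real \<Rightarrow> 'x :: {banach, second_countable_topology}"
    proof -
      note [measurable_cong] = that(1) and [measurable] = that(2)
      show ?thesis
        unfolding normalise_def by (subst integral_density) auto
    qed
    \<comment> \<open>Finitely many of the masses may vanish; there any probability measure will do.\<close>
    define Q where "Q n = (if m n = 0 then return borel 0 else normalise (M n))" for n
    have Q: "real_distribution (Q n)" for n
    proof (cases "m n = 0")
      case True
      then show ?thesis
        by (simp add: Q_def real_distribution_def real_distribution_axioms_def prob_space_return)
    next
      case False
      then show ?thesis
        using norm_dist[OF M, of n] by (simp add: Q_def m_def zero_less_measure_iff)
    qed
    have Q': "real_distribution (normalise M')"
      using pos' by (intro norm_dist M') (simp add: m'_def)
    have ev: "eventually (\<lambda>n. m n \<noteq> 0) sequentially"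
      using order_tendstoD(1)[OF m pos'] by eventually_elim simp
    have "(\<lambda>n. char (Q n) t) \<longlonglongrightarrow> char (normalise M') t" for t
    proof -
      have "(\<lambda>n. (1 / m n) *\<^sub>R char (M n) t) \<longlonglongrightarrow> (1 / m') *\<^sub>R char M' t"
        using pos' by (intro tendsto_intros m char) auto
      moreover have "eventually (\<lambda>n. (1 / m n) *\<^sub>R char (M n) t = char (Q n) t) sequentially"
        using ev by eventually_elim (simp add: Q_def char_def norm_int M.M_is_borel m_def)
      ultimately show ?thesis
        by (simp add: char_def norm_int M'.M_is_borel m'_def Lim_transform_eventually)
    qed
    then have "weak_conv_m Q (normalise M')"
      by (intro levy_continuity Q Q')
    then have "(\<lambda>n. \<integral>x. f x \<partial>Q n) \<longlonglongrightarrow> (\<integral>x. f x \<partial>normalise M')"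
      using f by (intro weak_conv_imp_integral_bdd_continuous_conv[OF Q Q']) auto
    then have "(\<lambda>n. m n * (\<integral>x. f x \<partial>Q n)) \<longlonglongrightarrow> m' * (\<integral>x. f x \<partial>normalise M')"
      by (intro tendsto_intros m)
    moreover have "m' * (\<integral>x. f x \<partial>normalise M') = (\<integral>x. f x \<partial>M')"
      using pos' by (simp add: norm_int M'.M_is_borel m'_def)
    moreover have "eventually (\<lambda>n. m n * (\<integral>x. f x \<partial>Q n) = (\<integral>x. f x \<partial>M n)) sequentially"
      using ev by eventually_elim (simp add: Q_def norm_int M.M_is_borel m_def)
    ultimately show ?thesis
      by (simp add: Lim_transform_eventually)
  qed
qed

text \<open>Weak convergence of finite measures on the line, for extending the limit to unbounded
  integrands.\<close>
locale weak_limit =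
  fixes M :: "nat \<Rightarrow> real measure" and M' :: "real measure"
  assumes M: "\<And>n. finite_borel_measure (M n)" and M': "finite_borel_measure M'"
    and weak: "\<And>f B. (\<And>x. isCont f x) \<Longrightarrow> (\<And>x. \<bar>f x\<bar> \<le> B) \<Longrightarrow>
      (\<lambda>n. \<integral>x. f x \<partial>M n) \<longlonglongrightarrow> (\<integral>x. f x \<partial>M' :: real)"
begin

lemma integrable_bounded_continuous:
  fixes f :: "real \<Rightarrow> real"
  assumes "finite_borel_measure N" "\<And>x. isCont f x" "\<And>x. \<bar>f x\<bar> \<le> B"
  shows "integrable N f"
proof -
  interpret finite_borel_measure N by (rule assms)
  note [measurable_cong] = M_is_borel
  have [measurable]: "f \<in> borel_measurable borel"
    using assms(2) by (intro borel_measurable_continuous_onI continuous_at_imp_continuous_on) auto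
  show ?thesis
    using assms(3) by (intro integrable_const_bound[of _ B]) auto
qed

text \<open>Fatou's lemma for weak convergence, from the bounded continuous truncations
  \<open>min (g x) k\<close>.\<close>
lemma integral_limit_le:
  fixes g :: "real \<Rightarrow> real"
  assumes g: "\<And>x. isCont g x" "\<And>x. 0 \<le> g x"
    and int: "\<And>n. integrable (M n) g" and C: "\<And>n. (\<integral>x. g x \<partial>M n) \<le> C"
  shows "integrable M' g" "(\<integral>x. g x \<partial>M') \<le> C"
proof -
  interpret M': finite_borel_measure M' by (rule M')
  note [measurable_cong] = M'.M_is_borel
  have [measurable]: "g \<in> borel_measurable borel"
    using g(1) by (intro borel_measurable_continuous_onI continuous_at_imp_continuous_on) auto
  have "0 \<le> C"
    using g(2) by (intro order_trans[OF integral_nonneg_AE C[of 0]]) auto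
  define h where "h k x = min (g x) (real k)" for k :: nat and x
  have h: "\<And>x. isCont (h k) x" "\<And>x. \<bar>h k x\<bar> \<le> real k" "\<And>x. 0 \<le> h k x" for k
    unfolding h_def using g by (auto intro!: continuous_intros)
  have "(\<integral>x. h k x \<partial>M') \<le> C" for k
  proof (rule LIMSEQ_le_const2)
    show "(\<lambda>n. \<integral>x. h k x \<partial>M n) \<longlonglongrightarrow> (\<integral>x. h k x \<partial>M')"
      by (rule weak[OF h(1,2)])
    have "(\<integral>x. h k x \<partial>M n) \<le> C" for n
    proof (rule order_trans[OF integral_mono C[of n]])
      show "integrable (M n) (h k)"
        by (rule integrable_bounded_continuous[OF M h(1,2)])
    qed (auto simp: h_def int)
    then show "\<exists>N. \<forall>n\<ge>N. (\<integral>x. h k x \<partial>M n) \<le> C"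
      by blast
  qed
  then have "(\<integral>\<^sup>+x. ennreal (h k x) \<partial>M') \<le> ennreal C" for k
    using h(3) by (subst nn_integral_eq_integral[OF integrable_bounded_continuous[OF M' h(1,2)]])
      (auto intro: ennreal_leI)
  then have "liminf (\<lambda>k. \<integral>\<^sup>+x. ennreal (h k x) \<partial>M') \<le> ennreal C"
    by (intro Liminf_le always_eventually allI) simp_all
  moreover have "(\<integral>\<^sup>+x. ennreal (g x) \<partial>M') \<le> liminf (\<lambda>k. \<integral>\<^sup>+x. ennreal (h k x) \<partial>M')"
  proof -
    have "liminf (\<lambda>k. ennreal (h k x)) = ennreal (g x)" for x
    proof (rule lim_imp_Liminf)
      have "eventually (\<lambda>k. ennreal (h k x) = ennreal (g x)) sequentially"
        using eventually_ge_at_top[of "nat \<lceil>g x\<rceil>"] by eventually_elim (simp add: h_def min_def nat_le_iff ceiling_le_iff)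
      then show "(\<lambda>k. ennreal (h k x)) \<longlonglongrightarrow> ennreal (g x)"
        by (rule tendsto_eventually)
    qed simp
    then show ?thesis
      using nn_integral_liminf[of "\<lambda>k x. ennreal (h k x)" M'] by (simp add: h_def)
  qed
  ultimately have le: "(\<integral>\<^sup>+x. ennreal (g x) \<partial>M') \<le> ennreal C"
    by (rule order_trans[rotated])
  show int': "integrable M' g"
  proof (rule integrableI_bounded)
    show "(\<integral>\<^sup>+x. ennreal (norm (g x)) \<partial>M') < \<infinity>"
      using le_less_trans[OF le ennreal_less_top] g(2) by simp
  qed measurable
  show "(\<integral>x. g x \<partial>M') \<le> C"
    using le g(2) \<open>0 \<le> C\<close> by (subst (asm) nn_integral_eq_integral[OF int']) auto
qed

text \<open>Cutting \<open>f\<close> at the height \<open>D\<close> changes each of the integrals by at most \<open>\<epsilon> C\<close>, since the part above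
  \<open>D\<close> is below \<open>\<epsilon> g\<close>; the truncation is bounded and continuous.\<close>
lemma integral_limit_uniformly_integrable:
  fixes f g :: "real \<Rightarrow> real"
  assumes f: "\<And>x. isCont f x" "\<And>x. 0 \<le> f x" and g: "\<And>x. isCont g x" "\<And>x. 0 \<le> g x"
    and int: "\<And>n. integrable (M n) g" and C: "\<And>n. (\<integral>x. g x \<partial>M n) \<le> C"
    and dom: "\<And>\<epsilon>. 0 < \<epsilon> \<Longrightarrow> \<exists>D. \<forall>x. f x \<le> \<epsilon> * g x + D"
  shows "integrable M' f" "(\<lambda>n. \<integral>x. f x \<partial>M n) \<longlonglongrightarrow> (\<integral>x. f x \<partial>M')"
proof -
  note lim = integral_limit_le[OF g int C]
  have "0 \<le> C"
    using g(2) by (intro order_trans[OF integral_nonneg_AE C[of 0]]) auto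
  have int_f: "integrable N f" if N: "finite_borel_measure N" "integrable N g" for N
  proof -
    interpret finite_borel_measure N by (rule N)
    note [measurable_cong] = M_is_borel
    have [measurable]: "f \<in> borel_measurable borel"
      using f(1) by (intro borel_measurable_continuous_onI continuous_at_imp_continuous_on) auto
    obtain D where D: "\<And>x. f x \<le> 1 * g x + D"
      using dom[of 1] by auto
    show ?thesis
    proof (rule Bochner_Integration.integrable_bound)
      show "integrable N (\<lambda>x. g x + D)"
        using N(2) by simp
      show "f \<in> borel_measurable N"
        by measurable
      show "AE x in N. norm (f x) \<le> norm (g x + D)"
      proof (intro AE_I2)
        fix x
        show "norm (f x) \<le> norm (g x + D)"
          using D[of x] f(2)[of x] by simp
      qed
    qed
  qed
  show "integrable M' f"
    by (rule int_f[OF M' lim(1)])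
  show "(\<lambda>n. \<integral>x. f x \<partial>M n) \<longlonglongrightarrow> (\<integral>x. f x \<partial>M')"
  proof (rule LIMSEQ_I)
    fix r :: real assume r: "0 < r"
    define \<epsilon> where "\<epsilon> = r / (2 * C + 2)"
    have "0 < \<epsilon>" "\<epsilon> * (2 * C + 2) = r"
      using r \<open>0 \<le> C\<close> by (auto simp: \<epsilon>_def intro!: divide_pos_pos)
    then have \<epsilon>: "0 < \<epsilon>" "2 * (\<epsilon> * C) + \<epsilon> < r"
      by (auto simp: algebra_simps)
    obtain D0 where D0: "\<And>x. f x \<le> \<epsilon> * g x + D0"
      using dom[OF \<epsilon>(1)] by blast
    define D where "D = max D0 0"
    define h where "h x = min (f x) D" for x
    have h: "\<And>x. isCont h x" "\<And>x. \<bar>h x\<bar> \<le> D"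
      unfolding h_def D_def using f by (auto intro!: continuous_intros)
    have cut: "\<bar>(\<integral>x. f x \<partial>N) - (\<integral>x. h x \<partial>N)\<bar> \<le> \<epsilon> * C"
      if N: "finite_borel_measure N" "integrable N g" "(\<integral>x. g x \<partial>N) \<le> C" for N
    proof -
      note ih = integrable_bounded_continuous[OF N(1) h]
      have "(\<integral>x. f x \<partial>N) - (\<integral>x. h x \<partial>N) = (\<integral>x. f x - h x \<partial>N)"
        using int_f[OF N(1,2)] ih by simp
      moreover have "0 \<le> (\<integral>x. f x - h x \<partial>N)"
        by (intro integral_nonneg_AE AE_I2) (simp add: h_def)
      moreover have "(\<integral>x. f x - h x \<partial>N) \<le> (\<integral>x. \<epsilon> * g x \<partial>N)"
      proof (rule integral_mono)
        have "f x - h x \<le> \<epsilon> * g x" for x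
          using D0[of x] mult_nonneg_nonneg[OF less_imp_le[OF \<epsilon>(1)] g(2)[of x]]
          unfolding h_def D_def min_def max_def by auto
        then show "\<And>x. x \<in> space N \<Longrightarrow> f x - h x \<le> \<epsilon> * g x" .
      qed (use int_f[OF N(1,2)] ih N in auto)
      moreover have "(\<integral>x. \<epsilon> * g x \<partial>N) \<le> \<epsilon> * C"
        using N \<epsilon> by simp
      ultimately show ?thesis
        by linarith
    qed
    obtain n0 where n0: "\<And>n. n0 \<le> n \<Longrightarrow> \<bar>(\<integral>x. h x \<partial>M n) - (\<integral>x. h x \<partial>M')\<bar> < \<epsilon>"
      using LIMSEQ_D[OF weak[OF h] \<epsilon>(1)] by auto
    have "norm ((\<integral>x. f x \<partial>M n) - (\<integral>x. f x \<partial>M')) < r" if "n0 \<le> n" for n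
      using n0[OF that] cut[OF M int C, of n] cut[OF M' lim] \<epsilon>(2) unfolding real_norm_def by linarith
    then show "\<exists>n0. \<forall>n\<ge>n0. norm ((\<integral>x. f x \<partial>M n) - (\<integral>x. f x \<partial>M')) < r"
      by blast
  qed
qed

end

section \<open>The law of the Beta factor\<close>

text \<open>This identity is why \<open>R\<close> is built from a \<open>Beta(1, 2)\<close> factor: the integral form of the second
  order Taylor remainder of the exponential is an expectation over that law.\<close>
lemma beta_exp: "(\<integral>\<^sup>+b. ennreal (exp (b * y)) \<partial>beta_1_2) = ennreal (2 * exp_rem y)"
proof -
  define F where "F b = (if y = 0 then 2 * b - b\<^sup>2 else 2 * exp (b * y) * ((1 - b) / y + 1 / y\<^sup>2))" for b
  have F: "(F has_real_derivative 2 * (1 - b) * exp (b * y)) (at b)" for b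
  proof (cases "y = 0")
    case True
    then show ?thesis
      unfolding F_def by (auto intro!: derivative_eq_intros)
  next
    case False
    then show ?thesis
      unfolding F_def by (auto intro!: derivative_eq_intros simp: field_simps power2_eq_square)
  qed
  have "(\<integral>\<^sup>+b. ennreal (exp (b * y)) \<partial>beta_1_2)
      = (\<integral>\<^sup>+b. ennreal (2 * (1 - b)) * indicator {0<..<1} b * ennreal (exp (b * y)) \<partial>lborel)"
    unfolding beta_1_2_def by (subst nn_integral_density) auto
  also have "\<dots> = (\<integral>\<^sup>+b. ennreal (2 * (1 - b) * exp (b * y)) * indicator {0..1} b \<partial>lborel)"
  proof (rule nn_integral_cong_AE)
    show "AE b in lborel. ennreal (2 * (1 - b)) * indicator {0<..<1} b * ennreal (exp (b * y))
        = ennreal (2 * (1 - b) * exp (b * y)) * indicator {0..1} b"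
      using AE_lborel_singleton[of "0::real"]
      by eventually_elim (auto simp: ennreal_mult'' split: split_indicator)
  qed
  also have "\<dots> = ennreal (F 1 - F 0)"
    using F by (intro nn_integral_FTC_Icc) auto
  also have "F 1 - F 0 = 2 * exp_rem y"
    by (cases "y = 0") (simp_all add: F_def exp_rem_def field_simps power2_eq_square)
  finally show ?thesis .
qed

text \<open>A domination that is uniform in \<open>t\<close>, for limits as \<open>t\<close> tends to \<open>0\<close>. Inside the Beta
  average, \<open>exp (t y) \<le> 1 + exp (T y)\<close> for either sign of \<open>y\<close>.\<close>
lemma exp_rem_le:
  assumes "0 \<le> t" "t \<le> T"
  shows "2 * exp_rem (t * x) \<le> 1 + 2 * exp_rem (T * x)"
proof -
  have le: "exp (b * (t * x)) \<le> 1 + exp (b * (T * x))" for b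
  proof (cases "0 \<le> b * x")
    case True
    then have "t * (b * x) \<le> T * (b * x)"
      using assms by (intro mult_right_mono) auto
    then have "exp (b * (t * x)) \<le> exp (b * (T * x))"
      by (simp add: ac_simps)
    then show ?thesis
      by linarith
  next
    case False
    then have "t * (b * x) \<le> 0"
      using assms False by (simp add: mult_nonneg_nonpos)
    then have "exp (b * (t * x)) \<le> 1"
      by (simp add: ac_simps)
    then show ?thesis
      using exp_gt_zero[of "b * (T * x)"] by linarith
  qed
  have "ennreal (2 * exp_rem (t * x)) \<le> (\<integral>\<^sup>+b. ennreal (exp (b * 0)) + ennreal (exp (b * (T * x))) \<partial>beta_1_2)"
    unfolding beta_exp[symmetric] using le
    by (intro nn_integral_mono) (simp add: ennreal_plus[symmetric] ennreal_1[symmetric] del: ennreal_plus ennreal_1)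
  also have "\<dots> = (\<integral>\<^sup>+b. ennreal (exp (b * 0)) \<partial>beta_1_2) + (\<integral>\<^sup>+b. ennreal (exp (b * (T * x))) \<partial>beta_1_2)"
    by (rule nn_integral_add) (simp_all add: beta_1_2_def)
  also have "\<dots> = ennreal (1 + 2 * exp_rem (T * x))"
    unfolding beta_exp using exp_rem_nonneg[of "T * x"] exp_rem_nonneg[of 0]
    by (subst ennreal_plus[symmetric]) (auto simp: exp_rem_def)
  finally show ?thesis
    using exp_rem_nonneg[of "T * x"] by (subst (asm) ennreal_le_iff) auto
qed

lemma integral_exp_rem_limit:
  fixes G :: "real measure"
  assumes [measurable_cong]: "sets G = sets borel" and [measurable]: "w \<in> borel_measurable borel"
    and w: "integrable G w" "\<And>x. 0 \<le> w x" and T: "0 < T" "integrable G (\<lambda>x. w x * exp_rem (T * x))"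
    and s: "s \<longlonglongrightarrow> 0" "\<And>n. 0 \<le> s n" "\<And>n. s n \<le> T"
  shows "(\<lambda>n. \<integral>x. w x * (2 * exp_rem (s n * x)) \<partial>G) \<longlonglongrightarrow> (\<integral>x. w x \<partial>G)"
proof (rule integral_dominated_convergence)
  show "integrable G (\<lambda>x. w x + 2 * (w x * exp_rem (T * x)))"
    using w T by simp
  have "(\<lambda>n. w x * (2 * exp_rem (s n * x))) \<longlonglongrightarrow> w x * (2 * exp_rem (0 * x))" for x
    by (intro tendsto_intros isCont_tendsto_compose[OF isCont_exp_rem] s)
  then show "AE x in G. (\<lambda>n. w x * (2 * exp_rem (s n * x))) \<longlonglongrightarrow> w x"
    by (simp add: exp_rem_def[of 0])
  show "AE x in G. norm (w x * (2 * exp_rem (s n * x))) \<le> w x + 2 * (w x * exp_rem (T * x))" for n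
  proof (intro AE_I2)
    fix x
    have "w x * (2 * exp_rem (s n * x)) \<le> w x * (1 + 2 * exp_rem (T * x))"
      by (intro mult_left_mono exp_rem_le s w)
    then show "norm (w x * (2 * exp_rem (s n * x))) \<le> w x + 2 * (w x * exp_rem (T * x))"
      using w(2)[of x] exp_rem_nonneg[of "s n * x"] by (simp add: abs_mult algebra_simps)
  qed
qed measurable

section \<open>The cumulant generating function in terms of the jump measure\<close>

text \<open>A centred infinitely divisible law with finite variance, given by its characteristic function
  only. The aim is to show that the L\'evy--Khintchine formula persists for real exponents wherever
  exponential moments exist.\<close>
locale infinitely_divisible_law = real_distribution \<mu> for \<mu> +
  fixes \<beta> a :: real and \<nu> :: "real measure"
  assumes infinitely_divisible: "infinitely_divisible \<mu>"
    and triplet: "levy_triplet \<mu> \<beta> a \<nu>"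
    and square_integrable: "integrable \<mu> (\<lambda>x. x\<^sup>2)"
    and centred: "(\<integral>x. x \<partial>\<mu>) = 0"
begin

abbreviation "\<psi> \<equiv> levy_exponent \<beta> a \<nu>"
abbreviation "H \<equiv> jump_measure a \<nu>"

text \<open>The index is shifted by one, so that every natural number gives a convolution root.\<close>
definition conv_root :: "nat \<Rightarrow> real measure" where
  "conv_root n = (SOME \<rho>. real_distribution \<rho> \<and>
     \<mu> = distr (\<Pi>\<^sub>M i\<in>{..<Suc n}. \<rho>) borel (\<lambda>x. \<Sum>i<Suc n. x i))"

lemma conv_root_iid_sum: "iid_sum (conv_root n) (Suc n) \<mu>"
proof -
  have "\<exists>\<rho>. real_distribution \<rho> \<and> \<mu> = distr (\<Pi>\<^sub>M i\<in>{..<Suc n}. \<rho>) borel (\<lambda>x. \<Sum>i<Suc n. x i)"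
    using infinitely_divisible unfolding infinitely_divisible_def by blast
  then have "real_distribution (conv_root n) \<and>
      \<mu> = distr (\<Pi>\<^sub>M i\<in>{..<Suc n}. conv_root n) borel (\<lambda>x. \<Sum>i<Suc n. x i)"
    unfolding conv_root_def by (rule someI_ex)
  then show ?thesis
    by (intro iid_sum.intro iid_sum_axioms.intro) auto
qed

lemma levy: "levy_measure \<nu>" and a_nonneg: "0 \<le> a" and sets_levy: "sets \<nu> = sets borel"
  and char_eq: "char \<mu> t = exp (\<psi> t)"
  using triplet by (auto simp: levy_triplet_def levy_measure_def levy_exponent_def levy_kernel_def)

lemma conv_root_distribution: "real_distribution (conv_root n)"
  using conv_root_iid_sum[of n] by (simp add: iid_sum_def)

lemma char_root: "char (conv_root n) t = exp (\<psi> t / of_nat (Suc n))"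
proof (rule root_of_exp_unique)
  show "isCont (char (conv_root n)) t" for t
    by (rule real_distribution.isCont_char[OF conv_root_distribution])
  show "char (conv_root n) t ^ Suc n = exp (\<psi> t)" for t
    using iid_sum.char_sum[OF conv_root_iid_sum, of t n] by (simp add: char_eq)
  show "char (conv_root n) 0 = 1"
    by (rule real_distribution.char_zero[OF conv_root_distribution])
qed (simp_all add: isCont_levy_exponent[OF levy])

lemma conv_root_char_limit: "(\<lambda>n. of_nat (Suc n) * (char (conv_root n) t - 1)) \<longlonglongrightarrow> \<psi> t"
  unfolding char_root by (rule scaled_exp_limit)

text \<open>Weighted, the rescaled convolution roots have bounded mass, and they turn out to converge weakly
  to the jump measure with the density \<open>osc_ratio\<close>.\<close>
definition osc_root :: "nat \<Rightarrow> real measure" where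
  "osc_root n = density (conv_root n) (\<lambda>x. ennreal (real (Suc n) * osc_weight x))"

definition osc_levy :: "real measure" where
  "osc_levy = density H (\<lambda>x. ennreal (osc_ratio x))"

lemma finite_osc_root: "finite_borel_measure (osc_root n)"
proof -
  interpret R: real_distribution "conv_root n" by (rule conv_root_distribution)
  have "emeasure (osc_root n) (space (osc_root n)) = (\<integral>\<^sup>+x. ennreal (real (Suc n) * osc_weight x) \<partial>conv_root n)"
    unfolding osc_root_def by (subst emeasure_density) (auto simp del: of_nat_Suc)
  also have "\<dots> \<le> (\<integral>\<^sup>+x. ennreal (real (Suc n) * 8) \<partial>conv_root n)"
    using osc_weight_le by (intro nn_integral_mono ennreal_leI mult_left_mono) auto
  also have "\<dots> < \<infinity>"
    using R.emeasure_space_1 by (simp del: of_nat_Suc add: ennreal_less_top)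
  finally show ?thesis
    by (intro finite_borel_measure.intro finite_measureI finite_borel_measure_axioms.intro)
      (auto simp: osc_root_def)
qed

lemma finite_osc_levy: "finite_borel_measure osc_levy"
proof -
  have "integrable H (\<lambda>x. Re (osc_ratio x *\<^sub>R iexp (0 * x)))"
    by (intro integrable_Re fourier_osc_ratio(1) levy a_nonneg)
  then have "integrable H osc_ratio"
    by simp
  then have "(\<integral>\<^sup>+x. ennreal (osc_ratio x) \<partial>H) < \<infinity>"
    using osc_ratio_pos by (simp add: integrable_iff_bounded less_imp_le)
  moreover have "emeasure osc_levy (space osc_levy) = (\<integral>\<^sup>+x. ennreal (osc_ratio x) \<partial>H)"
    unfolding osc_levy_def by (subst emeasure_density) auto
  ultimately show ?thesis
    by (intro finite_borel_measure.intro finite_measureI finite_borel_measure_axioms.intro)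
      (auto simp: osc_levy_def)
qed

lemma char_osc_root:
  "char (osc_root n) s =
     (2 * (of_nat (Suc n) * (char (conv_root n) s - 1)) - of_nat (Suc n) * (char (conv_root n) (s + 1) - 1)
        - of_nat (Suc n) * (char (conv_root n) (s - 1) - 1))
   + (2 * (of_nat (Suc n) * (char (conv_root n) s - 1)) - of_nat (Suc n) * (char (conv_root n) (s + sqrt 2) - 1)
        - of_nat (Suc n) * (char (conv_root n) (s - sqrt 2) - 1))"
proof -
  interpret R: real_distribution "conv_root n" by (rule conv_root_distribution)
  have int: "integrable (conv_root n) (\<lambda>x. iexp (t * x))" for t
    by (rule R.integrable_iexp) auto
  have "char (osc_root n) s = (CLINT x|conv_root n. (real (Suc n) * osc_weight x) *\<^sub>R iexp (s * x))"
    unfolding char_def osc_root_def using osc_weight_nonneg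
    by (subst integral_density) (auto simp del: of_nat_Suc)
  also have "\<dots> = (CLINT x|conv_root n. of_nat (Suc n) *
      ((2 * iexp (s * x) - iexp ((s + 1) * x) - iexp ((s - 1) * x))
        + (2 * iexp (s * x) - iexp ((s + sqrt 2) * x) - iexp ((s - sqrt 2) * x))))"
    unfolding second_difference_iexp distrib_right[symmetric] of_real_add[symmetric]
    by (simp add: osc_weight_def scaleR_conv_of_real mult.assoc del: of_nat_Suc)
  also have "\<dots> = of_nat (Suc n) *
      ((2 * char (conv_root n) s - char (conv_root n) (s + 1) - char (conv_root n) (s - 1))
        + (2 * char (conv_root n) s - char (conv_root n) (s + sqrt 2) - char (conv_root n) (s - sqrt 2)))"
    unfolding char_def by (simp only: integral_mult_right_zero Bochner_Integration.integral_add
      Bochner_Integration.integral_diff int Bochner_Integration.integrable_diff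
      Bochner_Integration.integrable_add integrable_mult_right)
  finally show ?thesis
    by (simp add: algebra_simps del: of_nat_Suc)
qed

lemma char_osc_levy:
  "char osc_levy s = (2 * \<psi> s - \<psi> (s + 1) - \<psi> (s - 1)) + (2 * \<psi> s - \<psi> (s + sqrt 2) - \<psi> (s - sqrt 2))"
proof -
  have "char osc_levy s = (CLINT x|H. osc_ratio x *\<^sub>R iexp (s * x))"
    unfolding char_def osc_levy_def using osc_ratio_pos
    by (subst integral_density) (auto simp: less_imp_le)
  then show ?thesis
    using fourier_osc_ratio(2)[OF levy a_nonneg] by simp
qed

sublocale osc: weak_limit osc_root osc_levy
proof (intro weak_limit.intro finite_osc_root finite_osc_levy)
  fix f :: "real \<Rightarrow> real" and B
  assume "\<And>x. isCont f x" "\<And>x. \<bar>f x\<bar> \<le> B"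
  moreover have "(\<lambda>n. char (osc_root n) s) \<longlonglongrightarrow> char osc_levy s" for s
    unfolding char_osc_root char_osc_levy by (intro tendsto_intros conv_root_char_limit)
  ultimately show "(\<lambda>n. \<integral>x. f x \<partial>osc_root n) \<longlonglongrightarrow> (\<integral>x. f x \<partial>osc_levy)"
    by (intro levy_continuity_finite finite_osc_root finite_osc_levy)
qed

text \<open>Dividing the integrand by \<open>osc_ratio\<close> undoes the weighting up to the factor \<open>x\<^sup>2\<close> that the jump
  measure contains.\<close>
lemma integral_osc_root:
  fixes F :: "real \<Rightarrow> real"
  assumes [measurable]: "F \<in> borel_measurable borel" and int: "integrable (conv_root n) (\<lambda>x. x\<^sup>2 * F x)"
  shows "integrable (osc_root n) (\<lambda>x. F x / osc_ratio x)"
    and "(\<integral>x. F x / osc_ratio x \<partial>osc_root n) = real (Suc n) * (\<integral>x. x\<^sup>2 * F x \<partial>conv_root n)"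
proof -
  interpret R: real_distribution "conv_root n" by (rule conv_root_distribution)
  have eq: "(real (Suc n) * osc_weight x) *\<^sub>R (F x / osc_ratio x) = real (Suc n) * (x\<^sup>2 * F x)" for x
    using osc_ratio_pos[of x] by (simp add: osc_weight_eq del: of_nat_Suc)
  have nonneg: "AE x in conv_root n. 0 \<le> real (Suc n) * osc_weight x"
    using osc_weight_nonneg by (intro AE_I2 mult_nonneg_nonneg) auto
  have meas: "(\<lambda>x. real (Suc n) * osc_weight x) \<in> borel_measurable (conv_root n)"
    "(\<lambda>x. F x / osc_ratio x) \<in> borel_measurable (conv_root n)"
    by measurable
  show "integrable (osc_root n) (\<lambda>x. F x / osc_ratio x)"
    unfolding osc_root_def integrable_density[OF meas(2,1) nonneg] eq
    by (intro integrable_mult_right int)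
  show "(\<integral>x. F x / osc_ratio x \<partial>osc_root n) = real (Suc n) * (\<integral>x. x\<^sup>2 * F x \<partial>conv_root n)"
    unfolding osc_root_def integral_density[OF meas(2,1) nonneg] eq
    by (rule integral_mult_right_zero)
qed

lemma integral_osc_levy:
  fixes F :: "real \<Rightarrow> real"
  assumes [measurable]: "F \<in> borel_measurable borel"
  shows "integrable osc_levy (\<lambda>x. F x / osc_ratio x) \<longleftrightarrow> integrable H F"
    and "(\<integral>x. F x / osc_ratio x \<partial>osc_levy) = (\<integral>x. F x \<partial>H)"
proof -
  have eq: "osc_ratio x *\<^sub>R (F x / osc_ratio x) = F x" for x
    using osc_ratio_pos[of x] by simp
  have nonneg: "AE x in H. 0 \<le> osc_ratio x"
    using osc_ratio_pos by (simp add: less_imp_le)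
  have meas: "osc_ratio \<in> borel_measurable H" "(\<lambda>x. F x / osc_ratio x) \<in> borel_measurable H"
    by measurable
  show "integrable osc_levy (\<lambda>x. F x / osc_ratio x) \<longleftrightarrow> integrable H F"
    unfolding osc_levy_def integrable_density[OF meas(2,1) nonneg] eq ..
  show "(\<integral>x. F x / osc_ratio x \<partial>osc_levy) = (\<integral>x. F x \<partial>H)"
    unfolding osc_levy_def integral_density[OF meas(2,1) nonneg] eq ..
qed

abbreviation "V \<equiv> (\<integral>x. x\<^sup>2 \<partial>\<mu>)"

lemma conv_root_moments:
  "integrable (conv_root n) (\<lambda>x. x\<^sup>2)" "integrable (conv_root n) (\<lambda>x. x)" "(\<integral>x. x \<partial>conv_root n) = 0"
  "real (Suc n) * (\<integral>x. x\<^sup>2 \<partial>conv_root n) = V"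
  using iid_sum.square_integrable_summand[OF conv_root_iid_sum square_integrable, of n]
    iid_sum.moments_summand[OF conv_root_iid_sum square_integrable centred, of n] by auto

text \<open>The weighted roots integrate \<open>1 / osc_ratio\<close> to the variance, so by Fatou's lemma the jump measure
  has at most that mass.\<close>
lemma finite_jump_measure: "integrable H (\<lambda>_. 1 :: real)"
proof -
  have "integrable osc_levy (\<lambda>x. 1 / osc_ratio x)"
  proof (rule osc.integral_limit_le(1))
    show "isCont (\<lambda>x. 1 / osc_ratio x) x" for x
      using osc_ratio_pos continuous_on_osc_ratio[OF continuous_on_id, of UNIV]
      by (intro continuous_intros) (auto simp: continuous_on_eq_continuous_at less_imp_neq[symmetric])
    show "0 \<le> 1 / osc_ratio x" for x
      using osc_ratio_pos[of x] by simp
    show "integrable (osc_root n) (\<lambda>x. 1 / osc_ratio x)" for n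
      using conv_root_moments(1) by (intro integral_osc_root(1)) auto
    show "(\<integral>x. 1 / osc_ratio x \<partial>osc_root n) \<le> V" for n
    proof -
      have "(\<integral>x. 1 / osc_ratio x \<partial>osc_root n) = real (Suc n) * (\<integral>x. x\<^sup>2 * 1 \<partial>conv_root n)"
        by (intro integral_osc_root(2)) (use conv_root_moments(1) in auto)
      then show ?thesis
        using conv_root_moments(4)[of n] by (simp only: mult_1_right)
    qed
  qed
  then show ?thesis
    by (subst (asm) integral_osc_levy(1)) auto
qed

lemma exp_integrable_below:
  assumes "integrable \<mu> (\<lambda>x. exp (T * x))" "0 \<le> t" "t \<le> T"
  shows "integrable \<mu> (\<lambda>x. exp (t * x))"
proof (rule Bochner_Integration.integrable_bound)
  show "integrable \<mu> (\<lambda>x. 1 + exp (T * x))"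
    using assms by simp
  have "exp (t * x) \<le> 1 + exp (T * x)" for x
  proof (cases "0 \<le> x")
    case True
    then have "exp (t * x) \<le> exp (T * x)"
      using assms by (simp add: mult_right_mono)
    then show ?thesis by linarith
  next
    case False
    then have "exp (t * x) \<le> 1"
      using assms by (simp add: mult_nonneg_nonpos)
    then show ?thesis
      using exp_gt_zero[of "T * x"] by linarith
  qed
  then show "AE x in \<mu>. norm (exp (t * x)) \<le> norm (1 + exp (T * x))"
    by (auto intro!: AE_I2 order_trans[OF _ abs_ge_self])
qed measurable

text \<open>The moment generating function of the \<open>n\<close>-th convolution root is the \<open>n\<close>-th root of that of
  \<open>\<mu>\<close>, and the linear term vanishes because the root is centred. The right-hand side tends to the
  cumulant generating function.\<close>
lemma conv_root_exp_rem:
  assumes int: "integrable \<mu> (\<lambda>x. exp (t * x))"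
  defines "F \<equiv> \<lambda>x. t\<^sup>2 * exp_rem (t * x)"
  shows "integrable (conv_root n) (\<lambda>x. x\<^sup>2 * F x)"
    and "real (Suc n) * (\<integral>x. x\<^sup>2 * F x \<partial>conv_root n)
      = real (Suc n) * (exp (ln (\<integral>x. exp (t * x) \<partial>\<mu>) / real (Suc n)) - 1)"
proof -
  interpret R: real_distribution "conv_root n" by (rule conv_root_distribution)
  define m where "m = (\<integral>x. exp (t * x) \<partial>\<mu>)"
  have pow: "ennreal m = (\<integral>\<^sup>+x. ennreal (exp (t * x)) \<partial>conv_root n) ^ Suc n"
    using iid_sum.mgf_sum[OF conv_root_iid_sum, of t n] int by (simp add: m_def nn_integral_eq_integral)
  have "(\<integral>\<^sup>+x. ennreal (exp (t * x)) \<partial>conv_root n) ^ Suc n \<noteq> top"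
    unfolding pow[symmetric] by simp
  then have fin: "(\<integral>\<^sup>+x. ennreal (exp (t * x)) \<partial>conv_root n) < \<infinity>"
    unfolding power_eq_top_ennreal by (simp add: less_top)
  have int': "integrable (conv_root n) (\<lambda>x. exp (t * x))"
    using fin by (intro integrableI_bounded) auto
  define r where "r = (\<integral>x. exp (t * x) \<partial>conv_root n)"
  have "ennreal m = ennreal r ^ Suc n"
    using pow by (simp only: r_def nn_integral_eq_integral[OF int'] exp_ge_zero AE_I2)
  moreover have r: "0 < r"
    unfolding r_def by (intro R.expectation_greater int') simp
  ultimately have "m = r ^ Suc n"
    by (simp add: ennreal_power m_def del: power_Suc)
  then have "ln m = real (Suc n) * ln r"
    using r by (simp only: ln_realpow)
  then have r_eq: "exp (ln m / real (Suc n)) = r"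
    using r by (simp del: of_nat_Suc)
  have eq: "x\<^sup>2 * F x = exp (t * x) - 1 - t * x" for x
    unfolding F_def exp_rem_eq by (simp add: power_mult_distrib)
  show "integrable (conv_root n) (\<lambda>x. x\<^sup>2 * F x)"
    unfolding eq using int' conv_root_moments(2) by auto
  have "(\<integral>x. x\<^sup>2 * F x \<partial>conv_root n) = r - 1"
    unfolding eq using int' conv_root_moments(2,3)[of n] R.prob_space by (simp add: r_def)
  then show "real (Suc n) * (\<integral>x. x\<^sup>2 * F x \<partial>conv_root n)
      = real (Suc n) * (exp (ln (\<integral>x. exp (t * x) \<partial>\<mu>) / real (Suc n)) - 1)"
    using r_eq by (simp add: m_def)
qed

text \<open>Both sides are limits of the integrals in \<open>conv_root_exp_rem\<close>. For the right-hand side, weak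
  convergence is applied to an unbounded integrand. The moment at the larger exponent \<open>T\<close> and the
  variance bound the dominating integrals, because these converge or are constant in \<open>n\<close>.\<close>
theorem cgf_eq:
  assumes int: "integrable \<mu> (\<lambda>x. exp (T * x))" and t: "0 < t" "t < T"
  shows "integrable H (\<lambda>x. exp_rem (t * x))"
    and "ln (\<integral>x. exp (t * x) \<partial>\<mu>) = t\<^sup>2 * (\<integral>x. exp_rem (t * x) \<partial>H)"
proof -
  define F where "F x = t\<^sup>2 * exp_rem (t * x)" for x
  define G where "G x = T\<^sup>2 * exp_rem (T * x)" for x
  have int_t: "integrable \<mu> (\<lambda>x. exp (t * x))"
    using t by (intro exp_integrable_below[OF int]) auto
  note F = conv_root_exp_rem[OF int_t, folded F_def] and G = conv_root_exp_rem[OF int, folded G_def]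
  have [measurable]: "F \<in> borel_measurable borel" "G \<in> borel_measurable borel"
    unfolding F_def G_def by measurable
  have "isCont (\<lambda>x. c\<^sup>2 * exp_rem (c * x)) x" for c x
    by (intro continuous_intros isCont_o2[OF _ isCont_exp_rem])
  moreover have "isCont osc_ratio x" for x
    using continuous_on_osc_ratio[OF continuous_on_id, of UNIV]
    by (simp add: continuous_on_eq_continuous_at)
  ultimately have cont: "isCont F x" "isCont G x" "isCont osc_ratio x" for x
    unfolding F_def G_def by blast+
  have pos: "0 \<le> F x" "0 \<le> G x" for x
    unfolding F_def G_def by (simp_all add: exp_rem_nonneg)
  have G1: "integrable (conv_root n) (\<lambda>x. x\<^sup>2 * (G x + 1))" for n
    using G(1)[of n] conv_root_moments(1)[of n] by (simp add: distrib_left)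
  have G1_eq: "real (Suc n) * (\<integral>x. x\<^sup>2 * (G x + 1) \<partial>conv_root n)
      = real (Suc n) * (exp (ln (\<integral>x. exp (T * x) \<partial>\<mu>) / real (Suc n)) - 1) + V" for n
  proof -
    have "(\<integral>x. x\<^sup>2 * (G x + 1) \<partial>conv_root n) = (\<integral>x. x\<^sup>2 * G x \<partial>conv_root n) + (\<integral>x. x\<^sup>2 \<partial>conv_root n)"
      using G(1)[of n] conv_root_moments(1)[of n] by (simp add: distrib_left)
    then show ?thesis
      using G(2)[of n] conv_root_moments(4)[of n] by (simp only: distrib_left)
  qed
  obtain C where C: "\<And>n. real (Suc n) * (exp (ln (\<integral>x. exp (T * x) \<partial>\<mu>) / real (Suc n)) - 1) \<le> C"
  proof -
    have "Bseq (\<lambda>n. real (Suc n) * (exp (ln (\<integral>x. exp (T * x) \<partial>\<mu>) / real (Suc n)) - 1))"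
      by (intro convergent_imp_Bseq convergentI[OF scaled_exp_limit])
    then show ?thesis
      using that unfolding Bseq_def real_norm_def by (blast dest: abs_le_D1)
  qed
  have lim: "integrable osc_levy (\<lambda>x. F x / osc_ratio x)"
    "(\<lambda>n. \<integral>x. F x / osc_ratio x \<partial>osc_root n) \<longlonglongrightarrow> (\<integral>x. F x / osc_ratio x \<partial>osc_levy)"
  proof -
    have c: "isCont (\<lambda>x. F x / osc_ratio x) x" "0 \<le> F x / osc_ratio x"
      "isCont (\<lambda>x. (G x + 1) / osc_ratio x) x" "0 \<le> (G x + 1) / osc_ratio x" for x
      using cont pos[of x] osc_ratio_pos[of x]
      by (auto intro!: continuous_intros simp: less_imp_neq[symmetric])
    have i: "integrable (osc_root n) (\<lambda>x. (G x + 1) / osc_ratio x)" for n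
      by (intro integral_osc_root(1) G1) measurable
    have mG: "(\<lambda>x. G x + 1) \<in> borel_measurable borel"
      by measurable
    have "(\<integral>x. (G x + 1) / osc_ratio x \<partial>osc_root n) \<le> C + V" for n
      unfolding integral_osc_root(2)[OF mG G1] G1_eq using C[of n] by linarith
    moreover have "\<exists>D. \<forall>x. F x / osc_ratio x \<le> \<epsilon> * ((G x + 1) / osc_ratio x) + D" if "0 < \<epsilon>" for \<epsilon>
      unfolding F_def G_def using t that by (rule exp_rem_dominated)
    ultimately show "integrable osc_levy (\<lambda>x. F x / osc_ratio x)"
      "(\<lambda>n. \<integral>x. F x / osc_ratio x \<partial>osc_root n) \<longlonglongrightarrow> (\<integral>x. F x / osc_ratio x \<partial>osc_levy)"
      using osc.integral_limit_uniformly_integrable[OF c i] by blast+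
  qed
  have "integrable H F"
    using lim(1) by (subst (asm) integral_osc_levy(1)) auto
  then show "integrable H (\<lambda>x. exp_rem (t * x))"
    using t unfolding F_def by simp
  have "(\<lambda>n. real (Suc n) * (exp (ln (\<integral>x. exp (t * x) \<partial>\<mu>) / real (Suc n)) - 1)) \<longlonglongrightarrow> (\<integral>x. F x \<partial>H)"
    using lim(2) by (simp only: integral_osc_root(2)[OF \<open>F \<in> borel_measurable borel\<close> F(1)] F(2)
      integral_osc_levy(2)[OF \<open>F \<in> borel_measurable borel\<close>])
  then have "ln (\<integral>x. exp (t * x) \<partial>\<mu>) = (\<integral>x. F x \<partial>H)"
    using LIMSEQ_unique scaled_exp_limit by blast
  then show "ln (\<integral>x. exp (t * x) \<partial>\<mu>) = t\<^sup>2 * (\<integral>x. exp_rem (t * x) \<partial>H)"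
    unfolding F_def by simp
qed

text \<open>Weak convergence alone could lose mass at infinity. Both \<open>ln E exp (t X)\<close> and
  \<open>t\<^sup>2 \<integral> exp_rem (t x) dH\<close> are quadratic in \<open>t\<close> near \<open>0\<close>, with coefficients half the variance and half the mass of
  the jump measure; the formula for the cumulant generating function identifies them.\<close>
theorem total_jump_mass:
  assumes int: "integrable \<mu> (\<lambda>x. exp (T * x))" and T: "0 < T"
  shows "emeasure H UNIV = ennreal V"
proof -
  define s where "s n = T / real (n + 3)" for n
  have "s n < T / 2" for n
    unfolding s_def by (rule divide_strict_left_mono) (use T in auto)
  moreover have "0 < s n" for n
    using T by (simp add: s_def)
  ultimately have s: "0 < s n" "s n \<le> T / 2" "s n < T" for n
    using T order.strict_trans[of "s n" "T / 2" T] less_imp_le by auto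
  have s0: "s \<longlonglongrightarrow> 0"
    unfolding s_def by real_asymp
  have exp_rem_int: "integrable \<mu> (\<lambda>x. x\<^sup>2 * exp_rem (t * x))" "(\<integral>x. exp (t * x) \<partial>\<mu>) = 1 + t\<^sup>2 * (\<integral>x. x\<^sup>2 * exp_rem (t * x) \<partial>\<mu>)"
    if t: "0 < t" "t \<le> T" for t
  proof -
    have it: "integrable \<mu> (\<lambda>x. exp (t * x))"
      using t by (intro exp_integrable_below[OF int]) auto
    have ix: "integrable \<mu> (\<lambda>x. x)"
      by (rule square_integrable_imp_integrable[OF _ square_integrable]) auto
    have eq: "x\<^sup>2 * exp_rem (t * x) = (exp (t * x) - 1 - t * x) / t\<^sup>2" for x
      unfolding exp_rem_eq using t by (simp add: power_mult_distrib)
    show "integrable \<mu> (\<lambda>x. x\<^sup>2 * exp_rem (t * x))"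
      unfolding eq using it ix by simp
    have "(\<integral>x. x\<^sup>2 * exp_rem (t * x) \<partial>\<mu>) = ((\<integral>x. exp (t * x) \<partial>\<mu>) - 1) / t\<^sup>2"
      unfolding eq using it ix centred prob_space by simp
    then show "(\<integral>x. exp (t * x) \<partial>\<mu>) = 1 + t\<^sup>2 * (\<integral>x. x\<^sup>2 * exp_rem (t * x) \<partial>\<mu>)"
      using t by simp
  qed
  \<comment> \<open>\<open>A\<close> and \<open>B\<close> are the second order coefficients of the moment generating function and of the
    cumulant generating function at \<open>s n\<close>; \<open>z - z\<^sup>2 \<le> ln (1 + z) \<le> z\<close> compares them.\<close>
  define A where "A n = (\<integral>x. x\<^sup>2 * (2 * exp_rem (s n * x)) \<partial>\<mu>)" for n
  define B where "B n = (\<integral>x. 1 * (2 * exp_rem (s n * x)) \<partial>H)" for n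
  have A: "A \<longlonglongrightarrow> V"
    unfolding A_def using T square_integrable s s0 exp_rem_int(1)[of "T / 2"]
    by (intro integral_exp_rem_limit[of _ _ "T / 2"]) (auto intro: less_imp_le)
  have B: "B \<longlonglongrightarrow> (\<integral>x. 1 \<partial>H)"
    unfolding B_def using T s s0 finite_jump_measure cgf_eq(1)[OF int, of "T / 2"]
    by (intro integral_exp_rem_limit[of _ _ "T / 2"]) (auto intro: less_imp_le)
  have z: "(\<lambda>n. (s n)\<^sup>2 / 2 * A n) \<longlonglongrightarrow> 0\<^sup>2 / 2 * V"
    by (intro tendsto_intros A s0) auto
  have A0: "0 \<le> A n" for n
    unfolding A_def by (intro integral_nonneg_AE AE_I2) (simp add: exp_rem_nonneg)
  have cgf_AB: "(s n)\<^sup>2 / 2 * B n = ln (1 + (s n)\<^sup>2 / 2 * A n)" for n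
  proof -
    have "ln (\<integral>x. exp (s n * x) \<partial>\<mu>) = (s n)\<^sup>2 / 2 * B n"
      using cgf_eq(2)[OF int s(1,3), of n] by (simp add: B_def)
    moreover have "(\<integral>x. exp (s n * x) \<partial>\<mu>) = 1 + (s n)\<^sup>2 / 2 * A n"
      using exp_rem_int(2)[OF s(1) less_imp_le[OF s(3)], of n] by (simp add: A_def mult.left_commute)
    ultimately show ?thesis
      by simp
  qed
  have upper: "B n \<le> A n" for n
  proof -
    have "(s n)\<^sup>2 / 2 * B n \<le> (s n)\<^sup>2 / 2 * A n"
      unfolding cgf_AB using A0[of n] by (intro ln_add_one_self_le_self) simp
    then show ?thesis
      using s(1)[of n] by simp
  qed
  have lower: "eventually (\<lambda>n. A n - (s n)\<^sup>2 / 2 * (A n)\<^sup>2 \<le> B n) sequentially"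
  proof -
    have "eventually (\<lambda>n. (s n)\<^sup>2 / 2 * A n < 1) sequentially"
      using order_tendstoD(2)[OF z, of 1] by simp
    then show ?thesis
    proof eventually_elim
      case (elim n)
      define c where "c = (s n)\<^sup>2 / 2"
      have c: "0 < c"
        using s(1)[of n] by (simp add: c_def)
      have "c * A n - (c * A n)\<^sup>2 \<le> ln (1 + c * A n)"
        using elim A0[of n] c by (intro ln_one_plus_pos_lower_bound) (auto simp: c_def)
      then have "c * (A n - c * (A n)\<^sup>2) \<le> c * B n"
        using cgf_AB[of n] by (simp add: c_def power_mult_distrib power2_eq_square algebra_simps)
      then show ?case
        using c by (simp add: c_def)
    qed
  qed
  have "(\<lambda>n. A n - (s n)\<^sup>2 / 2 * (A n)\<^sup>2) \<longlonglongrightarrow> V - 0\<^sup>2 / 2 * V\<^sup>2"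
    by (intro tendsto_intros A s0) auto
  then have L: "(\<lambda>n. A n - (s n)\<^sup>2 / 2 * (A n)\<^sup>2) \<longlonglongrightarrow> V"
    by simp
  have "B \<longlonglongrightarrow> V"
    by (rule tendsto_sandwich[OF lower _ L A]) (simp add: upper)
  then have "(\<integral>x. 1 \<partial>H) = V"
    using B LIMSEQ_unique by blast
  moreover have "(\<integral>\<^sup>+x. ennreal 1 \<partial>H) = ennreal (\<integral>x. 1 \<partial>H)"
    by (intro nn_integral_eq_integral finite_jump_measure) auto
  ultimately show ?thesis
    by simp
qed

end

section \<open>The cumulant generating function in terms of R\<close>

lemma beta_1_2_prob_space: "prob_space beta_1_2"
proof (rule prob_spaceI)
  have "emeasure beta_1_2 (space beta_1_2) = (\<integral>\<^sup>+b. ennreal (exp (b * 0)) \<partial>beta_1_2)"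
    by simp
  then show "emeasure beta_1_2 (space beta_1_2) = 1"
    unfolding beta_exp by (simp add: exp_rem_def)
qed

context infinitely_divisible_law
begin

context
  fixes T :: real
  assumes exp_int: "integrable \<mu> (\<lambda>x. exp (T * x))" and T_pos: "0 < T" and V_pos: "0 < V"
begin

lemma jump_law_prob_space: "prob_space (scale_measure (ennreal (1 / V)) H)"
proof (rule prob_spaceI)
  show "emeasure (scale_measure (ennreal (1 / V)) H) (space (scale_measure (ennreal (1 / V)) H)) = 1"
    using total_jump_mass[OF exp_int T_pos] V_pos
    by (simp add: space_scale_measure ennreal_mult[symmetric])
qed

lemma law_R_distribution: "real_distribution (law_R V a \<nu>)"
proof -
  interpret B: prob_space beta_1_2 by (rule beta_1_2_prob_space)
  interpret Z: prob_space "scale_measure (ennreal (1 / V)) H" by (rule jump_law_prob_space)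
  interpret pair_prob_space beta_1_2 "scale_measure (ennreal (1 / V)) H" ..
  have "(\<lambda>(b, z). b * z) \<in> borel_measurable (beta_1_2 \<Otimes>\<^sub>M scale_measure (ennreal (1 / V)) H)"
    by (simp add: beta_1_2_def cong: measurable_cong_sets)
  then show ?thesis
    unfolding law_R_def
    by (intro real_distribution.intro prob_space_distr real_distribution_axioms.intro) auto
qed

text \<open>By Tonelli, integrating out the Beta factor turns the moment generating function of \<open>R\<close> into the
  integral of \<open>2 exp_rem (t z)\<close> against the normalised jump measure.\<close>
lemma mgf_R_eq: "mgf_R V a \<nu> t = ennreal (1 / V) * (\<integral>\<^sup>+z. ennreal (2 * exp_rem (t * z)) \<partial>H)"
proof -
  define Z where "Z = scale_measure (ennreal (1 / V)) H"
  interpret B: prob_space beta_1_2 by (rule beta_1_2_prob_space)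
  interpret Z: prob_space Z unfolding Z_def by (rule jump_law_prob_space)
  interpret pair_prob_space beta_1_2 Z ..
  have [measurable_cong]: "sets beta_1_2 = sets borel" "sets Z = sets borel"
    by (simp_all add: beta_1_2_def Z_def)
  have "mgf_R V a \<nu> t = (\<integral>\<^sup>+p. ennreal (exp (t * (case p of (b, z) \<Rightarrow> b * z))) \<partial>(beta_1_2 \<Otimes>\<^sub>M Z))"
    unfolding mgf_R_def law_R_def Z_def[symmetric] by (subst nn_integral_distr) auto
  also have "\<dots> = (\<integral>\<^sup>+z. \<integral>\<^sup>+b. ennreal (exp (t * (b * z))) \<partial>beta_1_2 \<partial>Z)"
    by (subst nn_integral_snd[symmetric]) (auto simp: split_beta')
  also have "\<dots> = (\<integral>\<^sup>+z. ennreal (2 * exp_rem (t * z)) \<partial>Z)"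
    unfolding mult.left_commute[of t] beta_exp ..
  also have "\<dots> = ennreal (1 / V) * (\<integral>\<^sup>+z. ennreal (2 * exp_rem (t * z)) \<partial>H)"
    unfolding Z_def by (rule nn_integral_scale_measure) measurable
  finally show ?thesis .
qed

lemma cgf_eq_mgf_R:
  assumes t: "0 < t" "t < T"
  defines "m \<equiv> (\<integral>r. exp (t * r) \<partial>law_R V a \<nu>)"
  shows "integrable (law_R V a \<nu>) (\<lambda>r. exp (t * r))"
    and "mgf_R V a \<nu> t = ennreal m"
    and "ln (\<integral>x. exp (t * x) \<partial>\<mu>) = V * t\<^sup>2 / 2 * m"
proof -
  interpret R: real_distribution "law_R V a \<nu>" by (rule law_R_distribution)
  note K = cgf_eq[OF exp_int t]
  have "(\<integral>\<^sup>+z. ennreal (2 * exp_rem (t * z)) \<partial>H) = ennreal (\<integral>z. 2 * exp_rem (t * z) \<partial>H)"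
    using K(1) by (intro nn_integral_eq_integral) (auto simp: exp_rem_nonneg)
  also have "\<dots> = ennreal (2 * (\<integral>z. exp_rem (t * z) \<partial>H))"
    by simp
  finally have mgf: "mgf_R V a \<nu> t = ennreal (1 / V * (2 * (\<integral>z. exp_rem (t * z) \<partial>H)))"
    unfolding mgf_R_eq using V_pos by (simp only: ennreal_mult' divide_nonneg_nonneg zero_le_one less_imp_le)
  show int: "integrable (law_R V a \<nu>) (\<lambda>r. exp (t * r))"
    using mgf by (intro integrableI_bounded) (auto simp: mgf_R_def)
  show mgf': "mgf_R V a \<nu> t = ennreal m"
    unfolding mgf_R_def m_def by (intro nn_integral_eq_integral int) auto
  have "0 \<le> m"
    unfolding m_def by (intro integral_nonneg_AE) auto
  moreover have "0 \<le> 1 / V * (2 * (\<integral>z. exp_rem (t * z) \<partial>H))"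
    using V_pos by (intro mult_nonneg_nonneg integral_nonneg_AE) (auto simp: exp_rem_nonneg)
  ultimately have "m = 1 / V * (2 * (\<integral>z. exp_rem (t * z) \<partial>H))"
    using mgf mgf' by (metis ennreal_inj)
  then show "ln (\<integral>x. exp (t * x) \<partial>\<mu>) = V * t\<^sup>2 / 2 * m"
    unfolding K(2) using V_pos by simp
qed

end

end

lemma (in real_distribution) mgf_tangent:
  assumes "integrable M (\<lambda>r. r)" "integrable M (\<lambda>r. exp (t * r))"
  shows "1 + t * (\<integral>r. r \<partial>M) \<le> (\<integral>r. exp (t * r) \<partial>M)"
proof -
  have "(\<integral>r. 1 + t * r \<partial>M) \<le> (\<integral>r. exp (t * r) \<partial>M)"
    using assms by (intro integral_mono) auto
  then show ?thesis
    using assms prob_space by simp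
qed

text \<open>A moment generating function is convex, hence continuous on open intervals where it is finite.\<close>
lemma (in real_distribution) mgf_continuous_on:
  assumes int: "\<And>t. t \<in> {b<..<c} \<Longrightarrow> integrable M (\<lambda>r. exp (t * r))"
  shows "continuous_on {b<..<c} (\<lambda>t. \<integral>r. exp (t * r) \<partial>M)"
proof (rule convex_on_continuous)
  show "convex_on {b<..<c} (\<lambda>t. \<integral>r. exp (t * r) \<partial>M)"
  proof (rule convex_onI)
    fix u s t :: real
    assume u: "0 < u" "u < 1" and s: "s \<in> {b<..<c}" and t: "t \<in> {b<..<c}"
    have mem: "(1 - u) *\<^sub>R s + u *\<^sub>R t \<in> {b<..<c}"
      using convexD_alt[of "{b<..<c}" s t u] u s t by simp
    have "exp (((1 - u) *\<^sub>R s + u *\<^sub>R t) * r) \<le> (1 - u) * exp (s * r) + u * exp (t * r)" for r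
    proof -
      have "exp ((1 - u) *\<^sub>R (s * r) + u *\<^sub>R (t * r)) \<le> (1 - u) * exp (s * r) + u * exp (t * r)"
        using u by (intro convex_onD[OF exp_convex]) auto
      then show ?thesis
        by (simp add: algebra_simps)
    qed
    then have "(\<integral>r. exp (((1 - u) *\<^sub>R s + u *\<^sub>R t) * r) \<partial>M)
        \<le> (\<integral>r. (1 - u) * exp (s * r) + u * exp (t * r) \<partial>M)"
      by (intro integral_mono int[OF mem] Bochner_Integration.integrable_add integrable_mult_right int s t) auto
    also have "\<dots> = (1 - u) * (\<integral>r. exp (s * r) \<partial>M) + u * (\<integral>r. exp (t * r) \<partial>M)"
      using int[OF s] int[OF t] by simp
    finally show "(\<integral>r. exp (((1 - u) *\<^sub>R s + u *\<^sub>R t) * r) \<partial>M)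
        \<le> (1 - u) * (\<integral>r. exp (s * r) \<partial>M) + u * (\<integral>r. exp (t * r) \<partial>M)" .
  qed simp
qed simp

section \<open>The optimal scale near the variance\<close>

lemma c_star_nonneg: "0 \<le> c_star M X v"
  unfolding c_star_def by (intro Inf_greatest) auto

lemma c_star_le: "feasible M X v c \<Longrightarrow> c_star M X v \<le> ereal c"
  unfolding c_star_def by (intro Inf_lower) (auto simp: feasible_def)

lemma c_star_ge:
  "(\<And>c. feasible M X v c \<Longrightarrow> ereal m \<le> ereal c) \<Longrightarrow> ereal m \<le> c_star M X v"
  unfolding c_star_def by (intro Inf_greatest) auto

text \<open>The tangent of the square root at \<open>V\<close> has slope \<open>N x\<close> with \<open>N = 1 / sqrt (2 V x)\<close>, and the square
  root stays below its tangent. A point where the difference quotient of \<open>c\<^sub>*\<close> is below \<open>-N\<close> therefore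
  improves on \<open>V\<close>. If \<open>c\<^sub>*(V)\<close> is infinite, such a point has a finite value and improves trivially.\<close>
lemma y_star_less_if_derivative_MInf:
  assumes V: "V = prob_space.variance M X" "0 < V" and x: "0 < x"
    and lim: "((\<lambda>v. (c_star M X v - c_star M X V) / ereal (v - V)) \<longlongrightarrow> - \<infinity>) (at_right V)"
  shows "y_star M X x < ereal (sqrt (2 * V * x)) + c_star M X V * ereal x"
proof -
  define N where "N = 1 / sqrt (2 * V * x)"
  have N: "0 < N"
    using V x by (simp add: N_def)
  have "eventually (\<lambda>v. (c_star M X v - c_star M X V) / ereal (v - V) < ereal (- N)) (at_right V)"
    using lim by (simp add: tendsto_MInfty)
  then have "eventually (\<lambda>v. (c_star M X v - c_star M X V) / ereal (v - V) < ereal (- N) \<and> V < v) (at_right V)"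
    using eventually_at_right_less[of V] by eventually_elim simp
  then obtain v where v: "V < v" "(c_star M X v - c_star M X V) / ereal (v - V) < ereal (- N)"
    using eventually_happens'[OF trivial_limit_at_right_real] by blast
  have "y_star M X x \<le> ereal (sqrt (2 * v * x)) + c_star M X v * ereal x"
    unfolding y_star_def using v(1) V(1) by (intro INF_lower) simp
  also have "\<dots> < ereal (sqrt (2 * V * x)) + c_star M X V * ereal x"
  proof (cases "c_star M X v")
    case PInf
    then have "c_star M X v - c_star M X V = \<infinity>"
      by (cases "c_star M X V") auto
    with v show ?thesis
      by simp
  next
    case MInf
    then show ?thesis
      using c_star_nonneg[of M X v] by simp
  next
    case (real c)
    show ?thesis
    proof (cases "c_star M X V")
      case PInf
      then show ?thesis
        using real x by simp
    next
      case MInf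
      then show ?thesis
        using c_star_nonneg[of M X V] by simp
    next
      case C: (real C)
      have "(c - C) / (v - V) < - N"
        using v real C by simp
      then have "c - C < - N * (v - V)"
        using v(1) by (simp add: divide_less_eq)
      then have "c * x < (C - N * (v - V)) * x"
        using x by (intro mult_strict_right_mono) auto
      moreover have "sqrt (2 * v * x) \<le> sqrt (2 * V * x) + N * (v - V) * x"
      proof (rule real_le_lsqrt)
        have "(sqrt (2 * V * x) + N * (v - V) * x)\<^sup>2
            = 2 * V * x + 2 * (sqrt (2 * V * x) * N) * ((v - V) * x) + (N * (v - V) * x)\<^sup>2"
          using V x by (simp add: power2_sum)
        also have "sqrt (2 * V * x) * N = 1"
          using V x by (simp add: N_def)
        finally show "2 * v * x \<le> (sqrt (2 * V * x) + N * (v - V) * x)\<^sup>2"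
          by (simp add: algebra_simps)
        show "0 \<le> sqrt (2 * V * x) + N * (v - V) * x"
          using V x v(1) N by simp
      qed
      ultimately show ?thesis
        using real C by (simp add: algebra_simps)
    qed
  qed
  finally show ?thesis .
qed

text \<open>The bound that feasibility imposes is finite on \<open>[0, 1/c)\<close>, so \<open>\<tau>\<close> cannot be smaller than
  \<open>1/c\<close>. For \<open>c = 0\<close> this means \<open>\<tau> = \<infinity>\<close>, and the convention \<open>1/\<infinity> = 0\<close> applies.\<close>
lemma feasible_imp_boundary_le:
  assumes f: "feasible M X v c" and pos: "0 < exp_abscissa M X"
  shows "1 / exp_abscissa M X \<le> ereal c"
proof (cases "c = 0")
  case True
  have "ereal t \<le> exp_abscissa M X" if "0 < t" for t
  proof -
    have "cgf M X t < \<infinity>"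
      using f that True by (auto simp: feasible_def dest!: spec[of _ t] elim: le_less_trans)
    then show ?thesis
      unfolding exp_abscissa_def using that by (intro Sup_upper) auto
  qed
  then have "exp_abscissa M X = \<infinity>"
    by (intro ereal_top) (meson less_le_not_le linorder_not_le order_trans ereal_less_eq(3) zero_less_one linear)
  then show ?thesis
    using True by simp
next
  case False
  then have c: "0 < c"
    using f by (auto simp: feasible_def)
  have "ereal (1 / c) \<le> exp_abscissa M X"
  proof (rule dense_le)
    fix y assume "y < ereal (1 / c)"
    show "y \<le> exp_abscissa M X"
    proof (cases "y \<le> 0")
      case True
      then show ?thesis
        using pos by simp
    next
      case False
      then obtain t where t: "y = ereal t" "0 < t" "t < 1 / c"
        using \<open>y < ereal (1 / c)\<close> by (cases y) auto
      then have "cgf M X t < \<infinity>"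
        using f by (auto simp: feasible_def dest!: spec[of _ t] elim: le_less_trans)
      then show ?thesis
        unfolding exp_abscissa_def using t by (intro Sup_upper) auto
    qed
  qed
  then show ?thesis
    using c pos by (cases "exp_abscissa M X") (auto simp: field_simps one_ereal_def)
qed

lemma y_star_eq_if_boundary:
  assumes V: "V = prob_space.variance M X" "0 < V" and x: "0 < x" and pos: "0 < exp_abscissa M X"
    and c: "c_star M X V = 1 / exp_abscissa M X"
  shows "y_star M X x = ereal (sqrt (2 * V * x)) + c_star M X V * ereal x"
proof (rule antisym)
  show "y_star M X x \<le> ereal (sqrt (2 * V * x)) + c_star M X V * ereal x"
    unfolding y_star_def using V by (intro INF_lower) simp
  show "ereal (sqrt (2 * V * x)) + c_star M X V * ereal x \<le> y_star M X x"
    unfolding y_star_def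
  proof (rule INF_greatest)
    fix v assume "v \<in> {prob_space.variance M X..}"
    then have v: "V \<le> v"
      using V by simp
    have "c_star M X V \<le> c_star M X v"
      unfolding c c_star_def[of M X v] using feasible_imp_boundary_le[OF _ pos]
      by (intro Inf_greatest) auto
    then show "ereal (sqrt (2 * V * x)) + c_star M X V * ereal x
        \<le> ereal (sqrt (2 * v * x)) + c_star M X v * ereal x"
      using v x by (intro add_mono ereal_mult_right_mono) auto
  qed
qed

text \<open>Here \<open>m\<close> stands for the moment generating function of \<open>R\<close> and \<open>m1\<close> for its mean. The tangent
  bound gives \<open>c\<^sub>*(V) \<ge> m1\<close>, and for every \<open>N\<close> the pair \<open>(v, m1 - N (v - V))\<close> is feasible when \<open>v\<close> is
  close to \<open>V\<close>: near \<open>t = 0\<close> the factor \<open>v > V\<close> gives enough room, and away from \<open>0\<close> the strict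
  inequality \<open>1 - m1 t < 1 / m t\<close> has a positive margin by compactness.\<close>
lemma c_star_derivative_MInf:
  fixes m :: "real \<Rightarrow> real"
  assumes V: "0 < V" and m1: "0 < m1" "1 / m1 < T"
    and cgf: "\<And>t. 0 < t \<Longrightarrow> t \<le> T \<Longrightarrow> cgf M X t = ereal (V * t\<^sup>2 / 2 * m t)" "cgf M X 0 \<le> 0"
    and cont: "continuous_on {0<..T} m"
    and tangent: "\<And>t. 0 < t \<Longrightarrow> t \<le> T \<Longrightarrow> 1 + t * m1 \<le> m t"
    and below: "\<And>t. 0 < t \<Longrightarrow> t \<le> T \<Longrightarrow> 1 - m1 * t < 1 / m t"
  shows "((\<lambda>v. (c_star M X v - c_star M X V) / ereal (v - V)) \<longlongrightarrow> - \<infinity>) (at_right V)"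
proof -
  have T: "0 < T"
    using m1 less_trans[of 0 "1 / m1" T] by simp
  have m_pos: "0 < m t" if "0 < t" "t \<le> T" for t
    using tangent[OF that] mult_pos_pos[OF that(1) m1(1)] by linarith
  have lower: "ereal m1 \<le> c_star M X V"
  proof (rule c_star_ge)
    fix c assume f: "feasible M X V c"
    then have c0: "0 \<le> c"
      by (simp add: feasible_def)
    have key: "(1 + t * m1) * (1 - c * t) \<le> 1" if t: "0 < t" "t \<le> T" "c = 0 \<or> t < 1 / c" for t
    proof -
      have ct: "0 < 1 - c * t"
        using t c0 by (cases "c = 0") (auto simp: less_divide_eq mult.commute)
      have "cgf M X t \<le> ereal (V * t\<^sup>2 / (2 * (1 - c * t)))"
        using f t by (auto simp: feasible_def)
      then have "V * t\<^sup>2 / 2 * m t \<le> V * t\<^sup>2 / 2 * (1 / (1 - c * t))"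
        using cgf(1)[OF t(1,2)] by simp
      moreover have "0 < V * t\<^sup>2 / 2"
        using V t by simp
      ultimately have "m t \<le> 1 / (1 - c * t)"
        by (rule mult_left_le_imp_le)
      then have "m t * (1 - c * t) \<le> 1"
        using ct by (simp add: le_divide_eq)
      then show ?thesis
        using mult_right_mono[OF tangent[OF t(1,2)] less_imp_le[OF ct]] by linarith
    qed
    show "ereal m1 \<le> ereal c"
    proof (rule ccontr)
      assume "\<not> ereal m1 \<le> ereal c"
      then have less: "c < m1"
        by simp
      show False
      proof (cases "c = 0")
        case True
        then show False
          using key[of T] mult_pos_pos[OF T m1(1)] T by simp
      next
        case False
        then have c: "0 < c"
          using c0 by simp
        define u where "u = 1 / c - 1 / m1"
        define t where "t = min T (u / 2)"
        have "0 < u"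
          using c less by (simp add: u_def frac_less2)
        then have t: "0 < t" "t \<le> T" "t < u"
          using T by (auto simp: t_def min_less_iff_disj)
        then have t': "t < 1 / c - 1 / m1"
          by (simp only: u_def)
        have "0 < 1 / m1"
          using m1 by simp
        with t' have "t < 1 / c"
          by linarith
        then have "(1 + t * m1) * (1 - c * t) \<le> 1"
          using t by (intro key) auto
        then have "t * (m1 - c) \<le> t * (c * m1 * t)"
          by (simp add: algebra_simps)
        then have "m1 - c \<le> c * m1 * t"
          using t by simp
        also have "\<dots> < c * m1 * (1 / c - 1 / m1)"
          using t' c m1 by (intro mult_strict_left_mono) auto
        also have "\<dots> = m1 - c"
          using c m1 by (simp add: field_simps)
        finally show False
          by simp
      qed
    qed
  qed
  have upper: "eventually (\<lambda>v. c_star M X v \<le> ereal (m1 - N * (v - V))) (at_right V)"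
    if N: "0 < N" for N
  proof -
    \<comment> \<open>Up to \<open>t1\<close>, \<open>1 - c t \<ge> 1/2\<close> and \<open>N t \<le> 1 / (4 V)\<close>; it must not depend on \<open>v\<close>.\<close>
    define t1 where "t1 = min T (min (1 / (2 * m1)) (1 / (4 * V * N)))"
    have t1: "0 < t1" "t1 \<le> T" "t1 \<le> 1 / (2 * m1)" "t1 \<le> 1 / (4 * V * N)"
      using T m1 N V by (auto simp: t1_def)
    define g where "g t = 1 / m t - (1 - m1 * t)" for t
    have "continuous_on {t1..T} g"
      unfolding g_def using t1 m_pos
      by (intro continuous_intros continuous_on_subset[OF cont]) (auto simp: less_imp_neq[symmetric])
    then obtain s where s: "s \<in> {t1..T}" "\<And>t. t \<in> {t1..T} \<Longrightarrow> g s \<le> g t"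
      using continuous_attains_inf[of "{t1..T}" g] t1 by auto
    have g_pos: "0 < g t" if "0 < t" "t \<le> T" for t
      using below[OF that] by (simp add: g_def)
    have gs: "0 < g s"
      using s t1 by (intro g_pos) auto
    \<comment> \<open>The four bounds on \<open>v - V\<close> give \<open>v < 2 V\<close>, a slope term below the margin \<open>g s\<close>, a positive \<open>c\<close>,
      and \<open>1 / c < T\<close>, so that all relevant \<open>t\<close> lie in the range where \<open>m\<close> is controlled.\<close>
    define d where "d = min V (min (g s / (N * T)) (min (m1 / (2 * N)) ((m1 - 1 / T) / N)))"
    have "1 / T < m1"
      using m1 T by (simp add: divide_less_eq mult.commute)
    then have d: "0 < d"
      using V gs N T m1 by (simp add: d_def)
    have "c_star M X v \<le> ereal (m1 - N * (v - V))" if v: "V < v" "v < V + d" for v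
    proof (rule c_star_le)
      define c where "c = m1 - N * (v - V)"
      have "d \<le> V" "d \<le> g s / (N * T)" "d \<le> m1 / (2 * N)" "d \<le> (m1 - 1 / T) / N"
        unfolding d_def by linarith+
      then have "v - V < V" "v - V < g s / (N * T)" "v - V < m1 / (2 * N)" "v - V < (m1 - 1 / T) / N"
        using v by linarith+
      then have e: "v - V < V" "N * (v - V) * T < g s" "N * (v - V) < m1 / 2" "N * (v - V) < m1 - 1 / T"
        using N T by (simp_all add: less_divide_eq ac_simps)
      have c: "0 < c" "c \<le> m1" "1 / T < c"
        using e m1 N v by (auto simp: c_def)
      have cT: "1 / c < T"
        using c T by (simp add: divide_less_eq mult.commute)
      have "cgf M X t \<le> ereal (v * t\<^sup>2 / (2 * (1 - c * t)))" if t: "0 \<le> t" "t < 1 / c" for t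
      proof (cases "t = 0")
        case True
        then show ?thesis
          using cgf(2) by (simp add: zero_ereal_def)
      next
        case False
        then have t0: "0 < t" "t \<le> T"
          using t cT by auto
        have ct: "0 < 1 - c * t"
          using t c by (simp add: less_divide_eq mult.commute)
        have "N * (v - V) * t \<le> (v - V) / v * (1 - c * t) + g t"
        proof (cases "t \<le> t1")
          case True
          have "c * t \<le> m1 * (1 / (2 * m1))"
            using True t1 c t0 m1 by (intro mult_mono) auto
          then have half: "1 / 2 \<le> 1 - c * t"
            using m1 by simp
          have "N * t \<le> N * (1 / (4 * V * N))"
            using True t1 N by (intro mult_left_mono) auto
          then have "N * t \<le> 1 / (4 * V)"
            using N by simp
          also have "\<dots> = 1 / (2 * V) * (1 / 2)"
            by simp
          also have "\<dots> \<le> 1 / v * (1 - c * t)"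
            using half e v V by (intro mult_mono) (auto simp: frac_le)
          finally have "(v - V) * (N * t) \<le> (v - V) * (1 / v * (1 - c * t))"
            using v by (intro mult_left_mono) auto
          then show ?thesis
            using g_pos[OF t0] by (simp add: mult.commute mult.left_commute)
        next
          case False
          have "N * (v - V) * t \<le> N * (v - V) * T"
            using N v t0 by (intro mult_left_mono) auto
          also have "\<dots> \<le> g t"
            using e s(2)[of t] False t0 by auto
          finally have "N * (v - V) * t \<le> g t" .
          moreover have "0 \<le> (v - V) / v * (1 - c * t)"
            using ct v V by (intro mult_nonneg_nonneg divide_nonneg_nonneg) auto
          ultimately show ?thesis
            by linarith
        qed
        then have "(1 - c * t) * (1 - (v - V) / v) \<le> 1 / m t"
          by (simp add: g_def c_def algebra_simps)
        also have "1 - (v - V) / v = V / v"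
          using v V by (simp add: field_simps)
        finally have "V * m t \<le> v / (1 - c * t)"
          using ct v V m_pos[OF t0] by (simp add: field_simps)
        then have "t\<^sup>2 / 2 * (V * m t) \<le> t\<^sup>2 / 2 * (v / (1 - c * t))"
          by (intro mult_left_mono) auto
        then show ?thesis
          unfolding cgf(1)[OF t0] by (simp add: ac_simps)
      qed
      then show "feasible M X v (m1 - N * (v - V))"
        using c v V unfolding feasible_def c_def[symmetric] by auto
    qed
    then show ?thesis
      unfolding eventually_at_right_field using d by (intro exI[of _ "V + d"]) auto
  qed
  show ?thesis
    unfolding tendsto_MInfty
  proof
    fix r :: real
    define N where "N = max 1 (1 - r)"
    have N: "0 < N" "- N < r"
      by (auto simp: N_def)
    show "eventually (\<lambda>v. (c_star M X v - c_star M X V) / ereal (v - V) < ereal r) (at_right V)"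
      using upper[OF N(1)] eventually_at_right_less[of V]
    proof eventually_elim
      case (elim v)
      have "(c_star M X v - c_star M X V) / ereal (v - V)
          \<le> (ereal (m1 - N * (v - V)) - ereal m1) / ereal (v - V)"
        using elim lower by (intro ereal_divide_right_mono ereal_minus_mono) auto
      also have "\<dots> = ereal (- N)"
        using elim by simp
      also have "\<dots> < ereal r"
        using N by simp
      finally show ?case .
    qed
  qed
qed

lemma exp_abscissa_integrable:
  assumes "0 \<le> t" "ereal t < exp_abscissa M X"
  obtains T where "t < T" "integrable M (\<lambda>\<omega>. exp (T * X \<omega>))"
proof -
  obtain y where y: "y \<in> insert 0 {ereal t | t. 0 < t \<and> cgf M X t < \<infinity>}" "ereal t < y"
    using assms(2) unfolding exp_abscissa_def less_Sup_iff by blast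
  then obtain T where T: "y = ereal T" "cgf M X T < \<infinity>"
    using assms(1) by (auto simp: zero_ereal_def)
  then have "integrable M (\<lambda>\<omega>. exp (T * X \<omega>))"
    by (auto simp: cgf_def split: if_splits)
  then show ?thesis
    using that T(1) y(2) by simp
qed

text \<open>The condition \<open>m\<^sub>1 > 1/\<tau>\<close> leaves room for some \<open>T\<close> between \<open>1/m\<^sub>1\<close> and \<open>\<tau>\<close>, and below \<open>T\<close> the
  formula for the cumulant generating function applies. The mean of \<open>R\<close> exists because the Bochner
  integral of a function that is not integrable is \<open>0\<close>, whereas \<open>m\<^sub>1\<close> is positive.\<close>
lemma c_star_derivative_MInf_infinitely_divisible:
  fixes M :: "'a measure" and X :: "'a \<Rightarrow> real" and V \<beta> a :: real and \<nu> :: "real measure"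
  assumes M: "prob_space M" and X: "X \<in> borel_measurable M"
    and id: "infinitely_divisible (distr M borel X)" "levy_triplet (distr M borel X) \<beta> a \<nu>"
    and mean: "prob_space.expectation M X = 0" and sq: "integrable M (\<lambda>\<omega>. (X \<omega>)\<^sup>2)"
    and V: "V = prob_space.variance M X" "0 < V"
    and \<tau>: "0 < exp_abscissa M X" and m1: "0 < moment_R V a \<nu> 1"
    and \<Psi>: "\<And>t. 0 < t \<Longrightarrow> Psi1 V a \<nu> t < moment_R V a \<nu> 1"
    and bound: "exp_abscissa M X < \<infinity> \<Longrightarrow> 1 / exp_abscissa M X < ereal (moment_R V a \<nu> 1)"
  shows "((\<lambda>v. (c_star M X v - c_star M X V) / ereal (v - V)) \<longlongrightarrow> - \<infinity>) (at_right V)"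
proof -
  note [measurable] = X
  interpret M: prob_space M by (rule M)
  interpret \<mu>: infinitely_divisible_law "distr M borel X" \<beta> a \<nu>
    using id sq mean
    by (intro infinitely_divisible_law.intro infinitely_divisible_law_axioms.intro M.real_distribution_distr)
      (auto simp: integrable_distr_eq integral_distr)
  have V_eq: "(\<integral>x. x\<^sup>2 \<partial>distr M borel X) = V"
    using mean V(1) by (simp add: integral_distr)
  define m1 where "m1 = moment_R V a \<nu> 1"
  define R where "R = law_R V a \<nu>"
  define m where "m t = (\<integral>r. exp (t * r) \<partial>R)" for t
  have m1_pos: "0 < m1"
    using m1 by (simp add: m1_def)
  have "ereal (1 / m1) < exp_abscissa M X"
  proof (cases "exp_abscissa M X")
    case (real s)
    then have "0 < s" "1 / s < m1"
      using \<tau> bound by (auto simp: one_ereal_def m1_def)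
    then show ?thesis
      using real m1_pos by (simp add: field_simps)
  qed (use \<tau> in auto)
  then obtain T where T: "1 / m1 < T" "ereal T < exp_abscissa M X"
    using ereal_dense2[of "ereal (1 / m1)" "exp_abscissa M X"] by auto
  have T_pos: "0 < T"
    using T(1) m1_pos less_trans[of 0 "1 / m1" T] by simp
  obtain T' where T': "T < T'" "integrable M (\<lambda>\<omega>. exp (T' * X \<omega>))"
    using exp_abscissa_integrable[OF less_imp_le[OF T_pos] T(2)] by blast
  have int: "integrable (distr M borel X) (\<lambda>x. exp (T' * x))"
    using T'(2) by (simp add: integrable_distr_eq)
  have T'_pos: "0 < T'"
    using T_pos T'(1) by simp
  interpret R: real_distribution R
    using \<mu>.law_R_distribution[OF int T'_pos] V(2) by (simp add: V_eq R_def)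
  note mgf = \<mu>.cgf_eq_mgf_R[OF int T'_pos, unfolded V_eq, OF V(2), folded R_def, folded m_def]
  have m1_eq: "m1 = (\<integral>r. r \<partial>R)"
    by (simp add: m1_def moment_R_def R_def)
  then have "integrable R (\<lambda>r. r)"
    using m1_pos not_integrable_integral_eq by fastforce
  then have tangent: "1 + t * m1 \<le> m t" if "0 < t" "t < T'" for t
    unfolding m1_eq m_def using mgf(1)[OF that] by (intro R.mgf_tangent)
  show ?thesis
  proof (rule c_star_derivative_MInf[OF V(2) m1_pos T(1), of M X m])
    show "cgf M X 0 \<le> 0"
      by (simp add: cgf_def M.prob_space)
    have "continuous_on {0<..<T'} m"
      unfolding m_def using mgf(1) by (intro R.mgf_continuous_on) auto
    then show "continuous_on {0<..T} m"
      using T'(1) by (auto intro: continuous_on_subset)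
    fix t assume "0 < t" "t \<le> T"
    then have t: "0 < t" "t < T'"
      using T'(1) by auto
    show "1 + t * m1 \<le> m t"
      by (rule tangent[OF t])
    have "integrable M (\<lambda>\<omega>. exp (t * X \<omega>))"
      using \<mu>.exp_integrable_below[OF int, of t] t by (simp add: integrable_distr_eq)
    then show "cgf M X t = ereal (V * t\<^sup>2 / 2 * m t)"
      using mgf(3)[OF t] by (simp add: cgf_def integral_distr)
    have "0 < m t"
      using tangent[OF t] mult_pos_pos[OF t(1) m1_pos] by linarith
    then have "enn2real (1 / mgf_R V a \<nu> t) = 1 / m t"
      unfolding mgf(2)[OF t] by (simp add: divide_ennreal ennreal_1[symmetric] del: ennreal_1)
    then have "1 / t * (1 - 1 / m t) < m1"
      using \<Psi>[OF t(1)] by (simp add: Psi1_def m1_def)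
    then have "1 - 1 / m t < m1 * t"
      using t(1) by (simp add: divide_less_eq)
    then show "1 - m1 * t < 1 / m t"
      by linarith
  qed
qed

theorem corollary8p9:
  fixes M :: "'a measure" and X :: "'a \<Rightarrow> real" and V \<beta> a :: real and \<nu> :: "real measure"
  assumes "prob_space M"
    and "X \<in> borel_measurable M"
    and "infinitely_divisible (distr M borel X)"
    and "levy_triplet (distr M borel X) \<beta> a \<nu>"
    and "integrable M X" and "prob_space.expectation M X = 0"
    and "integrable M (\<lambda>\<omega>. (X \<omega>)\<^sup>2)"
    and "V = prob_space.variance M X" and "0 < V"
  shows
    "(exp_abscissa M X > 0 \<and>
      ((\<lambda>v. (c_star M X v - c_star M X V) / ereal (v - V)) \<longlongrightarrow> - \<infinity>) (at_right V)
      \<longrightarrow> (\<forall>x>0. y_star M X x < ereal (sqrt (2 * V * x)) + c_star M X V * ereal x))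
   \<and> ((\<integral>\<^sup>+x\<in>{x. 1 < \<bar>x\<bar>}. ennreal (x ^ 4) \<partial>\<nu>) < \<infinity> \<and>
      exp_abscissa M X > 0 \<and>
      moment_R V a \<nu> 1 > 0 \<and>
      kappa_R V a \<nu> > 0 \<and>
      (\<forall>t>0. Psi1 V a \<nu> t < moment_R V a \<nu> 1) \<and>
      (exp_abscissa M X < \<infinity> \<longrightarrow> ereal (moment_R V a \<nu> 1) > 1 / exp_abscissa M X)
      \<longrightarrow> (\<forall>x>0. y_star M X x < ereal (sqrt (2 * V * x)) + c_star M X V * ereal x))
   \<and> ((\<integral>\<^sup>+x\<in>{x. 1 < \<bar>x\<bar>}. ennreal (\<bar>x\<bar> ^ 5) \<partial>\<nu>) < \<infinity> \<and>
      exp_abscissa M X > 0 \<and>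
      moment_R V a \<nu> 1 > 0 \<and>
      (\<forall>t>0. Psi1 V a \<nu> t < moment_R V a \<nu> 1) \<and>
      (exp_abscissa M X < \<infinity> \<longrightarrow> ereal (moment_R V a \<nu> 1) > 1 / exp_abscissa M X) \<and>
      kappa_R V a \<nu> = 0 \<and>
      gamma_R V a \<nu> > 0
      \<longrightarrow> (\<forall>x>0. y_star M X x < ereal (sqrt (2 * V * x)) + c_star M X V * ereal x))
   \<and> (exp_abscissa M X > 0 \<and> c_star M X V > 0 \<and> c_star M X V = 1 / exp_abscissa M X
      \<longrightarrow> (\<forall>x>0. y_star M X x = ereal (sqrt (2 * V * x)) + c_star M X V * ereal x))"
proof -
  note setting = assms(1-4,6-9)
  have first: "y_star M X x < ereal (sqrt (2 * V * x)) + c_star M X V * ereal x"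
    if "((\<lambda>v. (c_star M X v - c_star M X V) / ereal (v - V)) \<longlongrightarrow> - \<infinity>) (at_right V)" "0 < x" for x
    by (rule y_star_less_if_derivative_MInf[OF assms(8,9) that(2,1)])
  show ?thesis
  proof (intro conjI impI allI; elim conjE)
    fix x :: real assume "0 < x"
    then show "((\<lambda>v. (c_star M X v - c_star M X V) / ereal (v - V)) \<longlongrightarrow> - \<infinity>) (at_right V) \<Longrightarrow>
        y_star M X x < ereal (sqrt (2 * V * x)) + c_star M X V * ereal x"
      by (intro first)
    \<comment> \<open>In (A), and then in (B), the assertion is the first part for the derivative \<open>-\<infinity>\<close>.\<close>
    show "y_star M X x < ereal (sqrt (2 * V * x)) + c_star M X V * ereal x"
      if "0 < exp_abscissa M X" "0 < moment_R V a \<nu> 1" "\<forall>t>0. Psi1 V a \<nu> t < moment_R V a \<nu> 1"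
        "exp_abscissa M X < \<infinity> \<longrightarrow> 1 / exp_abscissa M X < ereal (moment_R V a \<nu> 1)"
      using that \<open>0 < x\<close> by (intro first c_star_derivative_MInf_infinitely_divisible[OF setting]) auto
    then show "y_star M X x < ereal (sqrt (2 * V * x)) + c_star M X V * ereal x"
      if "0 < exp_abscissa M X" "0 < moment_R V a \<nu> 1" "\<forall>t>0. Psi1 V a \<nu> t < moment_R V a \<nu> 1"
        "exp_abscissa M X < \<infinity> \<longrightarrow> 1 / exp_abscissa M X < ereal (moment_R V a \<nu> 1)"
      using that by blast
    show "y_star M X x = ereal (sqrt (2 * V * x)) + c_star M X V * ereal x"
      if "0 < exp_abscissa M X" "c_star M X V = 1 / exp_abscissa M X"
      using that \<open>0 < x\<close> by (intro y_star_eq_if_boundary[OF assms(8,9)])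
  qed
qed

end
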